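(* Let $d>1$ be an integer and let $\mathcal{B}$ be the space of convex bodies in $\mathbb{R}^d$ with the Pompeiu-Hausdorff metric. For typical $K\in\mathcal{B}$ (i.e. for all $K\in\mathcal{B}$ outside a set of first Baire category in $\mathcal{B}$), the boundary of $K$ (which is smooth, so that curvature is defined) contains at least one umbilical point of infinite curvature, i.e. there is a boundary point $x$ of $K$ with $\kappa_i(x)=\kappa_s(x)=\infty$.
   Context: A convex body is a compact convex subset of $\mathbb{R}^d$ with nonempty interior. A convex surface is the boundary of a convex body. $\mathcal{B}$ denotes the set of all convex bodies in $\mathbb{R}^d$ with the Pompeiu-Hausdorff metric; it is a Baire space. A set is of first category if it is a countable union of nowhere dense sets. Typical elements of a Baire space have property $P$ if those elements not enjoying $P$ form a set of first category. A convex body has smooth boundary if its boundary is at least $C^1$; typical convex bodies are known to have smooth boundary. Curvature. Let $K$ be a convex body with smooth boundary $\mathrm{bd}(K)$, $x\in\mathrm{bd}(K)$, $\nu$ the inward unit normal to $\mathrm{bd}(K)$ at $x$, and $\tau$ a (nonzero) vector tangent to $\mathrm{bd}(K)$ at $x$. Let $Q=\{x+\lambda\nu+\mu\tau : \lambda,\mu\ge 0\}$. For $z\in \mathrm{bd}(K)\cap Q$, $z\ne x$, let $r_z$ be the radius of the circle which contains $x$ and $z$ and whose center lies in $\{x+\lambda\nu:\lambda\ge 0\}$ ($r_z=\infty$ if $z-x$ is orthogonal to $\nu$). Put $\rho_i^\tau(x)=\liminf_{z\to x} r_z$, $\rho_s^\tau(x)=\limsup_{z\to x} r_z$ (limits over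 such $z$), and $\kappa_i^\tau(x)=1/\rho_s^\tau(x)$ (lower curvature in direction $\tau$), $\kappa_s^\tau(x)=1/\rho_i^\tau(x)$ (upper curvature in direction $\tau$), with $1/0=\infty$ and $1/\infty=0$. Put $\kappa_i(x)=\inf_\tau \kappa_i^\tau(x)$ and $\kappa_s(x)=\sup_\tau\kappa_s^\tau(x)$, over all tangent directions $\tau$ at $x$. The curvature exists at $x$ (and $x$ is called umbilical) iff $\kappa_i(x)=\kappa_s(x)$, and this common value is then the curvature at $x$. *)

theory Defs
  imports "HOL-Analysis.Analysis"
begin

section \<open>The space of convex bodies\<close>

definition convex_bodies :: "'a::euclidean_space set set" where
  "convex_bodies = {K. convex K \<and> compact K \<and> interior K \<noteq> {}}"

text \<open>The guard only serves to make the function total: \<^locale>\<open>Metric_space\<close> requires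
  nonnegativity off the carrier as well, where the suprema may be unspecified.\<close>

definition hausdorff_dist :: "'a::euclidean_space set \<Rightarrow> 'a set \<Rightarrow> real" where
  "hausdorff_dist A B =
     (if A \<noteq> {} \<and> B \<noteq> {} \<and> bounded A \<and> bounded B
      then max (SUP a\<in>A. infdist a B) (SUP b\<in>B. infdist b A) else 0)"

lemma bdd_above_infdist:
  assumes "bounded A" "B \<noteq> {}"
  shows "bdd_above ((\<lambda>a. infdist a B) ` A)"
proof -
  obtain b where b: "b \<in> B" using assms by blast
  obtain e where e: "\<And>a. a \<in> A \<Longrightarrow> dist b a \<le> e"
    using assms(1) bounded_any_center[of A b] by blast
  show ?thesis
    by (rule bdd_aboveI2[where M = e]) (metis b e dist_commute infdist_le2)
qed

lemma infdist_le_hausdorff_dist: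
  assumes "A \<noteq> {}" "B \<noteq> {}" "bounded A" "bounded B" "a \<in> A"
  shows "infdist a B \<le> hausdorff_dist A B"
proof -
  have "infdist a B \<le> (SUP a\<in>A. infdist a B)"
    using assms by (intro cSUP_upper bdd_above_infdist)
  then show ?thesis using assms by (simp add: hausdorff_dist_def)
qed

lemma hausdorff_dist_commute: "hausdorff_dist A B = hausdorff_dist B A"
  by (auto simp: hausdorff_dist_def max.commute)

lemma hausdorff_dist_nonneg: "0 \<le> hausdorff_dist A B"
proof (cases "A \<noteq> {} \<and> B \<noteq> {} \<and> bounded A \<and> bounded B")
  case True
  then obtain a where "a \<in> A" by blast
  with True show ?thesis
    by (meson infdist_le_hausdorff_dist infdist_nonneg order_trans)
qed (auto simp: hausdorff_dist_def)

lemma hausdorff_dist_le: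
  assumes "A \<noteq> {}" "B \<noteq> {}" "bounded A" "bounded B"
    and "\<And>a. a \<in> A \<Longrightarrow> infdist a B \<le> e" "\<And>b. b \<in> B \<Longrightarrow> infdist b A \<le> e"
  shows "hausdorff_dist A B \<le> e"
  using assms by (simp add: hausdorff_dist_def cSUP_least)

lemma infdist_hausdorff_triangle:
  assumes "A \<noteq> {}" "B \<noteq> {}" "C \<noteq> {}" "bounded A" "compact B" "bounded C" "a \<in> A"
  shows "infdist a C \<le> hausdorff_dist A B + hausdorff_dist B C"
proof -
  obtain b where b: "b \<in> B" "infdist a B = dist a b"
    using infdist_attains_inf[of B a] assms compact_imp_closed by blast
  have "infdist a C \<le> infdist b C + dist a b" by (rule infdist_triangle)
  also have "infdist b C \<le> hausdorff_dist B C"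
    using assms b compact_imp_bounded by (intro infdist_le_hausdorff_dist) auto
  also have "dist a b \<le> hausdorff_dist A B"
    using assms compact_imp_bounded
    by (subst b(2)[symmetric], intro infdist_le_hausdorff_dist) auto
  finally show ?thesis by simp
qed

lemma convex_bodiesD:
  assumes "K \<in> convex_bodies"
  shows "convex K" "compact K" "closed K" "bounded K" "K \<noteq> {}" "interior K \<noteq> {}"
  using assms compact_imp_closed compact_imp_bounded interior_subset
  by (auto simp: convex_bodies_def)

lemma Metric_space_convex_bodies: "Metric_space convex_bodies hausdorff_dist"
proof
  fix A B :: "'a set"
  show "0 \<le> hausdorff_dist A B" by (rule hausdorff_dist_nonneg)
  show "hausdorff_dist A B = hausdorff_dist B A" by (rule hausdorff_dist_commute)
next
  fix A B :: "'a set"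
  assume A: "A \<in> convex_bodies" and B: "B \<in> convex_bodies"
  note * = convex_bodiesD[OF A] convex_bodiesD[OF B]
  show "hausdorff_dist A B = 0 \<longleftrightarrow> A = B"
  proof
    assume 0: "hausdorff_dist A B = 0"
    have "a \<in> B" if "a \<in> A" for a
      using infdist_le_hausdorff_dist[of A B a] * 0 that infdist_nonneg[of a B]
        in_closed_iff_infdist_zero[of B a] by auto
    moreover have "b \<in> A" if "b \<in> B" for b
      using infdist_le_hausdorff_dist[of B A b] * 0 that infdist_nonneg[of b A]
        in_closed_iff_infdist_zero[of A b] hausdorff_dist_commute[of A B] by auto
    ultimately show "A = B" by blast
  next
    assume "A = B"
    then have "hausdorff_dist A B \<le> 0"
      using * by (intro hausdorff_dist_le) auto
    then show "hausdorff_dist A B = 0" using hausdorff_dist_nonneg[of A B] by simp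
  qed
next
  fix A B C :: "'a set"
  assume A: "A \<in> convex_bodies" and B: "B \<in> convex_bodies" and C: "C \<in> convex_bodies"
  note * = convex_bodiesD[OF A] convex_bodiesD[OF B] convex_bodiesD[OF C]
  show "hausdorff_dist A C \<le> hausdorff_dist A B + hausdorff_dist B C"
  proof (rule hausdorff_dist_le)
    show "infdist a C \<le> hausdorff_dist A B + hausdorff_dist B C" if "a \<in> A" for a
      using * that by (intro infdist_hausdorff_triangle) auto
    show "infdist c A \<le> hausdorff_dist A B + hausdorff_dist B C" if "c \<in> C" for c
      using infdist_hausdorff_triangle[of C B A c] * that
        hausdorff_dist_commute[of A B] hausdorff_dist_commute[of B C] by auto
  qed (use * in auto)
qed

definition convex_body_topology :: "'a::euclidean_space set topology" where
  "convex_body_topology = Metric_space.mtopology convex_bodies hausdorff_dist"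

section \<open>Baire category\<close>

definition nowhere_dense_in :: "'a topology \<Rightarrow> 'a set \<Rightarrow> bool" where
  "nowhere_dense_in X N \<longleftrightarrow>
     N \<subseteq> topspace X \<and> X interior_of (X closure_of N) = {}"

definition first_category_in :: "'a topology \<Rightarrow> 'a set \<Rightarrow> bool" where
  "first_category_in X S \<longleftrightarrow>
     (\<exists>\<N>. countable \<N> \<and> (\<forall>N\<in>\<N>. nowhere_dense_in X N) \<and> S = \<Union>\<N>)"

definition typical_convex_body :: "('a::euclidean_space set \<Rightarrow> bool) \<Rightarrow> bool" where
  "typical_convex_body P \<longleftrightarrow>
     first_category_in convex_body_topology {K \<in> convex_bodies. \<not> P K}"

section \<open>Curvature\<close>

text \<open>The boundary is a hypersurface of class \<open>C\<^sup>1\<close>: locally the zero set of a continuously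
  differentiable function without critical points.\<close>

definition smooth_boundary :: "'a::euclidean_space set \<Rightarrow> bool" where
  "smooth_boundary K \<longleftrightarrow>
     (\<forall>x\<in>frontier K. \<exists>U g g'. open U \<and> x \<in> U \<and>
        (\<forall>y\<in>U. GDERIV g y :> g' y) \<and> continuous_on U g' \<and> (\<forall>y\<in>U. g' y \<noteq> 0) \<and>
        frontier K \<inter> U = {y \<in> U. g y = 0})"

text \<open>The inward unit normal at a boundary point of a convex body: \<open>K\<close> lies in the half-space
  into which it points. It is unique if the boundary is smooth; otherwise the value is arbitrary.\<close>

definition inward_normal :: "'a::euclidean_space set \<Rightarrow> 'a \<Rightarrow> 'a" where
  "inward_normal K x = (THE \<nu>. norm \<nu> = 1 \<and> (\<forall>y\<in>K. 0 \<le> (y - x) \<bullet> \<nu>))"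

definition tangent_directions :: "'a::euclidean_space set \<Rightarrow> 'a \<Rightarrow> 'a set" where
  "tangent_directions K x = {\<tau>. \<tau> \<noteq> 0 \<and> orthogonal \<tau> (inward_normal K x)}"

definition quarter_plane :: "'a::euclidean_space \<Rightarrow> 'a \<Rightarrow> 'a \<Rightarrow> 'a set" where
  "quarter_plane x \<nu> \<tau> = {x + l *\<^sub>R \<nu> + m *\<^sub>R \<tau> | l m. 0 \<le> l \<and> 0 \<le> m}"

definition circle_radius :: "'a::euclidean_space \<Rightarrow> 'a \<Rightarrow> 'a \<Rightarrow> ennreal" where
  "circle_radius x \<nu> z =
     (if orthogonal (z - x) \<nu> then \<infinity>
      else ennreal (THE r. \<exists>c \<in> {x + l *\<^sub>R \<nu> | l. 0 \<le> l}. dist c x = r \<and> dist c z = r))"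

definition boundary_section :: "'a::euclidean_space set \<Rightarrow> 'a \<Rightarrow> 'a \<Rightarrow> 'a set" where
  "boundary_section K x \<tau> = frontier K \<inter> quarter_plane x (inward_normal K x) \<tau>"

text \<open>The filter \<^term>\<open>at x within S\<close> excludes \<^term>\<open>x\<close> itself.\<close>

definition lower_radius_dir :: "'a::euclidean_space set \<Rightarrow> 'a \<Rightarrow> 'a \<Rightarrow> ennreal" where
  "lower_radius_dir K x \<tau> =
     Liminf (at x within boundary_section K x \<tau>) (circle_radius x (inward_normal K x))"

definition upper_radius_dir :: "'a::euclidean_space set \<Rightarrow> 'a \<Rightarrow> 'a \<Rightarrow> ennreal" where
  "upper_radius_dir K x \<tau> =
     Limsup (at x within boundary_section K x \<tau>) (circle_radius x (inward_normal K x))"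

text \<open>In \<^typ>\<open>ennreal\<close>, \<open>1 / 0 = \<infinity>\<close> and \<open>1 / \<infinity> = 0\<close>.\<close>

definition lower_curvature_dir :: "'a::euclidean_space set \<Rightarrow> 'a \<Rightarrow> 'a \<Rightarrow> ennreal" where
  "lower_curvature_dir K x \<tau> = 1 / upper_radius_dir K x \<tau>"

definition upper_curvature_dir :: "'a::euclidean_space set \<Rightarrow> 'a \<Rightarrow> 'a \<Rightarrow> ennreal" where
  "upper_curvature_dir K x \<tau> = 1 / lower_radius_dir K x \<tau>"

definition lower_curvature :: "'a::euclidean_space set \<Rightarrow> 'a \<Rightarrow> ennreal" where
  "lower_curvature K x = (INF \<tau>\<in>tangent_directions K x. lower_curvature_dir K x \<tau>)"

definition upper_curvature :: "'a::euclidean_space set \<Rightarrow> 'a \<Rightarrow> ennreal" where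
  "upper_curvature K x = (SUP \<tau>\<in>tangent_directions K x. upper_curvature_dir K x \<tau>)"

definition umbilical :: "'a::euclidean_space set \<Rightarrow> 'a \<Rightarrow> bool" where
  "umbilical K x \<longleftrightarrow> lower_curvature K x = upper_curvature K x"

end

theory Submission
  imports Defs
begin

text \<open>The bodies with a boundary point at which two unit normals differ by at least a given
  amount form a nowhere dense set, because outer parallel bodies are dense and a body near one
  of them has only narrow normal cones (\<open>nowhere_dense_in_wide_normal_cones\<close>). Hence typical
  bodies have unique normals, and this makes their gauge function continuously differentiable
  (\<open>smooth_boundary_if_unique_normals\<close>).

  For the point of infinite curvature it suffices to find a point \<open>x\<close> of \<open>K\<close> such that for each
  \<open>r > 0\<close> some neighbourhood of \<open>x\<close> in \<open>K\<close> is contained in a ball of radius \<open>r\<close> with \<open>x\<close> on its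
  boundary (\<open>infinitely_curved_point\<close>). A body near \<open>K\<close> may look quite different from \<open>K\<close> at
  fine scales, so \<open>x\<close> is obtained as a limit along which the body is sharpened at finer and
  finer scales. Suppose \<open>K\<close> lies, near its point \<open>x\<close>, in a ball with \<open>x\<close> on its boundary. Pull
  \<open>x\<close> slightly outwards, along the line through the centre, and take the convex hull. The apex
  of the spiked body is the vertex of a cone (\<open>spike\<close>), so that close to the apex the body lies
  in a ball of half the radius, and at larger scales it still lies in the old ball, enlarged
  concentrically so as to have the apex on its boundary. Both facts persist for all bodies close to the spiked one: the latter by compactness
  (\<open>near_spike_annulus\<close>), and the former for the point that is locally farthest from the centre
  of the smaller ball (\<open>near_spike_touching_ball\<close>). This is one round of an infinite
  construction (\<open>refine_stage\<close>). In each round the scales and the radii shrink, the positions of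
  the touching point converge, and the limit point inherits the containment in the \<open>n\<close>-th ball
  for the \<open>n\<close>-th range of scales (\<open>stage_limit\<close>).

  Since each round can be played inside an arbitrary open set of bodies, a Banach--Mazur
  argument shows that all bodies outside a set of first category arise from an infinite sequence
  of rounds (\<open>first_category_in_no_branch\<close>).\<close>

section \<open>Sets of first category and infinite plays\<close>

lemma nowhere_dense_inI:
  assumes "N \<subseteq> topspace X"
    and "\<And>W. \<lbrakk>openin X W; W \<noteq> {}\<rbrakk> \<Longrightarrow> \<exists>V. openin X V \<and> V \<inter> W \<noteq> {} \<and> V \<inter> N = {}"
  shows "nowhere_dense_in X N"
proof -
  let ?W = "X interior_of (X closure_of N)"
  have "?W = {}"
  proof (rule ccontr)
    assume "?W \<noteq> {}"
    then obtain V where V: "openin X V" "V \<inter> ?W \<noteq> {}" "V \<inter> N = {}"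
      using assms(2)[of ?W] by auto
    then have "V \<inter> X closure_of N = {}"
      using openin_Int_closure_of_eq_empty by blast
    then show False
      using V(2) interior_of_subset[of X "X closure_of N"] by blast
  qed
  then show ?thesis
    using assms(1) by (simp add: nowhere_dense_in_def)
qed

lemma nowhere_dense_in_subset:
  assumes "nowhere_dense_in X N" "M \<subseteq> N"
  shows "nowhere_dense_in X M"
  using assms interior_of_mono[OF closure_of_mono[OF assms(2)]]
  unfolding nowhere_dense_in_def by blast

lemma first_category_in_UN:
  assumes "\<And>n::nat. nowhere_dense_in X (N n)" "S \<subseteq> (\<Union>n. N n)"
  shows "first_category_in X S"
  unfolding first_category_in_def
proof (intro exI conjI)
  show "countable (range (\<lambda>n. S \<inter> N n))" by simp
  show "\<forall>N\<in>range (\<lambda>n. S \<inter> N n). nowhere_dense_in X N"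
    using assms(1) by (auto intro: nowhere_dense_in_subset)
  show "S = \<Union> (range (\<lambda>n. S \<inter> N n))"
    using assms(2) by auto
qed

lemma first_category_in_Un:
  assumes "first_category_in X A" "first_category_in X B" "S \<subseteq> A \<union> B"
  shows "first_category_in X S"
proof -
  obtain \<M> \<N> where *: "countable \<M>" "\<forall>N\<in>\<M>. nowhere_dense_in X N" "A = \<Union>\<M>"
    "countable \<N>" "\<forall>N\<in>\<N>. nowhere_dense_in X N" "B = \<Union>\<N>"
    using assms unfolding first_category_in_def by auto
  show ?thesis
    unfolding first_category_in_def
  proof (intro exI conjI)
    show "countable ((\<inter>) S ` (\<M> \<union> \<N>))" using * by simp
    show "\<forall>N\<in>(\<inter>) S ` (\<M> \<union> \<N>). nowhere_dense_in X N"
      using * by (auto intro: nowhere_dense_in_subset)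
    show "S = \<Union> ((\<inter>) S ` (\<M> \<union> \<N>))" using * assms(3) by auto
  qed
qed

lemma first_category_in_subset:
  assumes "first_category_in X A" "S \<subseteq> A"
  shows "first_category_in X S"
  using first_category_in_Un[OF assms(1) assms(1), of S] assms(2) by auto

text \<open>Well-order the index set and remove from each \<open>U s\<close> the closure of the union of its
  predecessors; the remainders are open and disjoint. Nothing is lost up to density: an open \<open>W\<close>
  that meets some \<open>U s\<close> is disjoint from the predecessors of the least \<open>U t\<close> that it meets,
  hence from the closure of their union, so that \<open>W\<close> keeps all of its points in \<open>U t\<close>.\<close>

lemma disjoint_dense_refinement:
  fixes U :: "'p \<Rightarrow> 'x set"
  assumes U: "\<And>s. s \<in> A \<Longrightarrow> openin X (U s)"
  shows "\<exists>V. (\<forall>s\<in>A. openin X (V s) \<and> V s \<subseteq> U s) \<and>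
    (\<forall>s\<in>A. \<forall>t\<in>A. V s \<inter> V t \<noteq> {} \<longrightarrow> s = t) \<and>
    (\<forall>W. \<forall>s\<in>A. openin X W \<and> W \<inter> U s \<noteq> {} \<longrightarrow> (\<exists>t\<in>A. W \<inter> V t \<noteq> {}))"
proof -
  obtain r where r: "well_order_on A r"
    using well_order_on by blast
  then have wf: "wf (r - Id)" and tot: "total_on A r"
    by (auto simp: well_order_on_def linear_order_on_def)
  define P where "P s = (\<Union>t\<in>{t\<in>A. (t, s) \<in> r - Id}. U t)" for s
  define V where "V s = U s - X closure_of (P s)" for s
  have Ptop: "P s \<subseteq> topspace X" for s
    unfolding P_def using openin_subset[OF U] by (intro UN_least) auto
  have disj: "V s \<inter> V t = {}" if "s \<in> A" "t \<in> A" "(s, t) \<in> r - Id" for s t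
  proof -
    have "V s \<subseteq> P t" 
      using that unfolding V_def P_def by (intro subset_trans[OF Diff_subset]) (rule UN_upper, simp)
    also have "\<dots> \<subseteq> X closure_of (P t)" by (rule closure_of_subset[OF Ptop])
    finally show ?thesis by (auto simp: V_def)
  qed
  show ?thesis
  proof (intro exI[of _ V] conjI ballI allI impI)
    fix s assume "s \<in> A"
    then show "openin X (V s)" unfolding V_def using U by (simp add: openin_diff)
    show "V s \<subseteq> U s" by (auto simp: V_def)
  next
    fix s t assume "s \<in> A" "t \<in> A" "V s \<inter> V t \<noteq> {}"
    then show "s = t"
      using disj[of s t] disj[of t s] tot by (auto simp: total_on_def)
  next
    fix W s assume W: "openin X W \<and> W \<inter> U s \<noteq> {}" and s: "s \<in> A"
    define B where "B = {t\<in>A. W \<inter> U t \<noteq> {}}"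
    have "s \<in> B" using W s by (simp add: B_def)
    then obtain t where t: "t \<in> B" "\<And>u. (u, t) \<in> r - Id \<Longrightarrow> u \<notin> B"
      using wfE_min[OF wf] by metis
    have "W \<inter> P t = {}"
      using t(2) unfolding P_def B_def by blast
    then have "W \<inter> X closure_of (P t) = {}"
      using W openin_Int_closure_of_eq_empty by blast
    then have "W \<inter> V t = W \<inter> U t" by (auto simp: V_def)
    then show "\<exists>t\<in>A. W \<inter> V t \<noteq> {}" using t(1) by (auto simp: B_def)
  qed
qed

text \<open>This is the Banach--Mazur game in disguise: \<open>S\<close> is the set of positions, \<open>R\<close> the relation
  of being a legal continuation, and \<open>step\<close> says that the player who wants to move inside \<open>U\<close>
  can always do so, whatever open set the opponent has just chosen. Then all points outside a
  set of first category lie on an infinite legal play. The continuation may depend on the whole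
  past, and uncountably many positions compete at each stage. For this reason the open sets of
  each level are made disjoint: a point lying in one open set of each level then determines a
  single coherent play.\<close>

lemma first_category_in_no_branch:
  fixes U :: "'p \<Rightarrow> 'x set"
  assumes op: "\<And>s. s \<in> S \<Longrightarrow> openin X (U s)"
    and start: "\<And>W. \<lbrakk>openin X W; W \<noteq> {}\<rbrakk> \<Longrightarrow> \<exists>s\<in>S. W \<inter> U s \<noteq> {}"
    and step: "\<And>s W. \<lbrakk>s \<in> S; openin X W; W \<noteq> {}; W \<subseteq> U s\<rbrakk>
                \<Longrightarrow> \<exists>t\<in>S. R s t \<and> W \<inter> U t \<noteq> {}"
  shows "first_category_in X {x \<in> topspace X.
           \<not> (\<exists>\<sigma>. \<forall>n::nat. \<sigma> n \<in> S \<and> R (\<sigma> n) (\<sigma> (Suc n)) \<and> x \<in> U (\<sigma> n))}"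
proof -
  have "\<exists>V. (\<forall>s\<in>A. openin X (V s) \<and> V s \<subseteq> Q \<inter> U s) \<and>
    (\<forall>s\<in>A. \<forall>t\<in>A. V s \<inter> V t \<noteq> {} \<longrightarrow> s = t) \<and>
    (\<forall>W. \<forall>s\<in>A. openin X W \<and> W \<inter> (Q \<inter> U s) \<noteq> {} \<longrightarrow> (\<exists>t\<in>A. W \<inter> V t \<noteq> {}))"
    if "A \<subseteq> S" "openin X Q" for A Q
    using op that by (intro disjoint_dense_refinement openin_Int) auto
  then obtain ref where ref: "\<And>A Q. A \<subseteq> S \<Longrightarrow> openin X Q \<Longrightarrow>
    (\<forall>s\<in>A. openin X (ref A Q s) \<and> ref A Q s \<subseteq> Q \<inter> U s) \<and>
    (\<forall>s\<in>A. \<forall>t\<in>A. ref A Q s \<inter> ref A Q t \<noteq> {} \<longrightarrow> s = t) \<and>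
    (\<forall>W. \<forall>s\<in>A. openin X W \<and> W \<inter> (Q \<inter> U s) \<noteq> {} \<longrightarrow> (\<exists>t\<in>A. W \<inter> ref A Q t \<noteq> {}))"
    by metis
  have ref_open: "openin X (ref A Q s)" and ref_sub: "ref A Q s \<subseteq> Q \<inter> U s"
    if "A \<subseteq> S" "openin X Q" "s \<in> A" for A Q s
    using ref[OF that(1,2)] that(3) by simp_all
  have ref_disj: "s = t"
    if "A \<subseteq> S" "openin X Q" "s \<in> A" "t \<in> A" "x \<in> ref A Q s" "x \<in> ref A Q t" for A Q s t x
    using ref[OF that(1,2)] that(3-) by (metis disjoint_iff)
  have ref_dense: "\<exists>t\<in>A. W \<inter> ref A Q t \<noteq> {}"
    if "A \<subseteq> S" "openin X Q" "s \<in> A" "openin X W" "W \<inter> (Q \<inter> U s) \<noteq> {}" for A Q s W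
    using conjunct2[OF conjunct2[OF ref[OF that(1,2)]], THEN spec, THEN bspec, OF that(3)] that(4,5)
    by simp
  define E where "E s = {t\<in>S. R s t}" for s
  have ES: "E s \<subseteq> S" for s by (auto simp: E_def)
  \<comment> \<open>The \<open>n\<close>-th level of the tree of plays: a position together with the disjointified open set
    allotted to it.\<close>
  define L where "L = rec_nat {(s, ref S (topspace X) s) |s. s \<in> S}
     (\<lambda>_ \<L>. {(t, ref (E s) Q t) |s Q t. (s, Q) \<in> \<L> \<and> t \<in> E s})"
  have L0: "L 0 = {(s, ref S (topspace X) s) |s. s \<in> S}"
    and LSuc: "L (Suc n) = {(t, ref (E s) Q t) |s Q t. (s, Q) \<in> L n \<and> t \<in> E s}" for n
    by (simp_all add: L_def)
  have inv: "s \<in> S \<and> openin X Q \<and> Q \<subseteq> U s" if "(s, Q) \<in> L n" for s Q n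
    using that
  proof (induction n arbitrary: s Q)
    case 0
    then show ?case
      using ref_open[of S "topspace X" s] ref_sub[of S "topspace X" s] by (auto simp: L0)
  next
    case (Suc n)
    then obtain s' Q' where *: "(s', Q') \<in> L n" "s \<in> E s'" "Q = ref (E s') Q' s"
      by (auto simp: LSuc)
    then show ?case
      using ref_open[OF ES[of s'], of Q' s] ref_sub[OF ES[of s'], of Q' s] Suc.IH[OF *(1)] ES[of s']
      by auto
  qed
  have disj: "(s, Q) = (s', Q')"
    if "(s, Q) \<in> L n" "(s', Q') \<in> L n" "x \<in> Q" "x \<in> Q'" for s Q s' Q' n x
    using that
  proof (induction n arbitrary: s Q s' Q')
    case 0
    then have "s \<in> S" "s' \<in> S" "Q = ref S (topspace X) s" "Q' = ref S (topspace X) s'"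
      by (auto simp: L0)
    then show ?case using ref_disj[OF order_refl openin_topspace, of s s' x] 0(3,4) by simp
  next
    case (Suc n)
    obtain a P a' P' where *: "(a, P) \<in> L n" "s \<in> E a" "Q = ref (E a) P s"
      "(a', P') \<in> L n" "s' \<in> E a'" "Q' = ref (E a') P' s'"
      using Suc.prems(1,2) unfolding LSuc by blast
    have r: "openin X P" "openin X P'" using inv * by blast+
    have "x \<in> P" "x \<in> P'"
      using ref_sub[OF ES r(1) *(2)] ref_sub[OF ES r(2) *(5)] * Suc.prems(3,4) by auto
    then have eq: "a' = a" "P' = P" using Suc.IH[OF *(1,4)] by auto
    show ?case
      using ref_disj[OF ES r(1) *(2), of s' x] * Suc.prems(3,4) unfolding eq by simp
  qed
  have dense: "\<exists>(s, Q)\<in>L n. W \<inter> Q \<noteq> {}" if W: "openin X W" "W \<noteq> {}" for W n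
  proof (induction n)
    case 0
    obtain s where s: "s \<in> S" "W \<inter> U s \<noteq> {}" using start[OF W] by blast
    then have "W \<inter> (topspace X \<inter> U s) \<noteq> {}" using openin_subset[OF W(1)] by blast
    then obtain t where "t \<in> S" "W \<inter> ref S (topspace X) t \<noteq> {}"
      using ref_dense[OF order_refl openin_topspace s(1) W(1)] by blast
    then show ?case unfolding L0 by blast
  next
    case (Suc n)
    then obtain s Q where sQ: "(s, Q) \<in> L n" "W \<inter> Q \<noteq> {}" by blast
    note i = inv[OF sQ(1)]
    have "\<exists>t\<in>S. R s t \<and> (W \<inter> Q) \<inter> U t \<noteq> {}"
      using i sQ(2) W(1) by (intro step openin_Int) auto
    then obtain t where t: "t \<in> E s" "(W \<inter> Q) \<inter> U t \<noteq> {}"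
      unfolding E_def by auto
    then have "W \<inter> (Q \<inter> U t) \<noteq> {}" by blast
    then obtain t' where "t' \<in> E s" "W \<inter> ref (E s) Q t' \<noteq> {}"
      using ref_dense[OF ES _ t(1) W(1)] i by blast
    then show ?case using sQ(1) unfolding LSuc by blast
  qed
  define G where "G n = (\<Union>(s, Q)\<in>L n. Q)" for n
  have Gopen: "openin X (G n)" for n
    unfolding G_def using inv by (intro openin_Union) auto
  show ?thesis
  proof (rule first_category_in_UN)
    show "nowhere_dense_in X (topspace X - G n)" for n
    proof (rule nowhere_dense_inI)
      fix W assume "openin X W" "W \<noteq> {}"
      from dense[OF this, of n] show "\<exists>V. openin X V \<and> V \<inter> W \<noteq> {} \<and> V \<inter> (topspace X - G n) = {}"
        using Gopen[of n] by (intro exI[of _ "G n"]) (auto simp: G_def)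
    qed auto
    show "{x \<in> topspace X.
       \<not> (\<exists>\<sigma>. \<forall>n::nat. \<sigma> n \<in> S \<and> R (\<sigma> n) (\<sigma> (Suc n)) \<and> x \<in> U (\<sigma> n))} \<subseteq> (\<Union>n. topspace X - G n)"
    proof (rule subsetI, rule ccontr)
      fix x assume x: "x \<in> {x \<in> topspace X.
       \<not> (\<exists>\<sigma>. \<forall>n::nat. \<sigma> n \<in> S \<and> R (\<sigma> n) (\<sigma> (Suc n)) \<and> x \<in> U (\<sigma> n))}"
        "x \<notin> (\<Union>n. topspace X - G n)"
      \<comment> \<open>A point in all the \<open>G n\<close> picks one node of each level; disjointness makes each the
        parent of the next.\<close>
      then have "\<forall>n. \<exists>s Q. (s, Q) \<in> L n \<and> x \<in> Q" by (fastforce simp: G_def)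
      then obtain \<sigma> Q where \<sigma>: "\<And>n. (\<sigma> n, Q n) \<in> L n" "\<And>n. x \<in> Q n" by metis
      have "R (\<sigma> n) (\<sigma> (Suc n))" for n
      proof -
        obtain s P where *: "(s, P) \<in> L n" "\<sigma> (Suc n) \<in> E s" "Q (Suc n) = ref (E s) P (\<sigma> (Suc n))"
          using \<sigma>(1)[of "Suc n"] unfolding LSuc by blast
        have "x \<in> P" using ref_sub[OF ES _ *(2), of P] inv[OF *(1)] *(3) \<sigma>(2)[of "Suc n"] by auto
        then have "s = \<sigma> n" using disj[OF *(1) \<sigma>(1)[of n]] \<sigma>(2) by blast
        then show ?thesis using *(2) by (simp add: E_def)
      qed
      moreover have "\<sigma> n \<in> S" "x \<in> U (\<sigma> n)" for n
        using inv[OF \<sigma>(1)[of n]] \<sigma>(2)[of n] by auto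
      ultimately show False using x(1) by blast
    qed
  qed
qed

section \<open>Typical convex bodies are smooth\<close>

lemma hausdorff_dist_lessD:
  assumes "A \<in> convex_bodies" "B \<in> convex_bodies" "hausdorff_dist A B < e" "a \<in> A"
  shows "\<exists>b\<in>B. dist a b < e"
proof -
  note * = convex_bodiesD[OF assms(1)] convex_bodiesD[OF assms(2)]
  obtain b where b: "b \<in> B" "infdist a B = dist a b"
    using infdist_attains_inf[of B a] * by blast
  have "infdist a B \<le> hausdorff_dist A B"
    using * assms(4) by (intro infdist_le_hausdorff_dist) auto
  then show ?thesis using b assms(3) by (intro bexI[of _ b]) auto
qed

definition unit_normal :: "'a::euclidean_space set \<Rightarrow> 'a \<Rightarrow> 'a \<Rightarrow> bool" where
  "unit_normal K x u \<longleftrightarrow> norm u = 1 \<and> (\<forall>y\<in>K. 0 \<le> (y - x) \<bullet> u)"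

definition unique_normals :: "'a::euclidean_space set \<Rightarrow> bool" where
  "unique_normals K \<longleftrightarrow> (\<forall>x\<in>K. \<forall>u v. unit_normal K x u \<longrightarrow> unit_normal K x v \<longrightarrow> u = v)"

interpretation convex_bodies: Metric_space "convex_bodies :: 'a::euclidean_space set set" hausdorff_dist
  by (rule Metric_space_convex_bodies)

text \<open>Outer parallel bodies are dense among the convex bodies, and each of their boundary points
  lies on a ball of radius \<open>e\<close> contained in the body, so that their normals are unique.\<close>

lemma outer_parallel_body:
  fixes K :: "'a::euclidean_space set"
  assumes K: "K \<in> convex_bodies" and e: "0 < e"
  defines "L \<equiv> {x + y |x y. x \<in> K \<and> y \<in> cball 0 e}"
  shows "L \<in> convex_bodies" "hausdorff_dist K L \<le> e"
proof -
  note k = convex_bodiesD[OF K]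
  have sub: "K \<subseteq> L"
  proof
    fix x assume "x \<in> K"
    then show "x \<in> L" using e unfolding L_def by (intro CollectI exI[of _ x] exI[of _ 0]) auto
  qed
  have "L = (\<Union>x\<in>K. \<Union>y\<in>cball 0 e. {x + y})" unfolding L_def by blast
  then have "convex L" using convex_sums[OF k(1) convex_cball[of 0 e]] by simp
  moreover have "compact L"
    unfolding L_def by (rule compact_sums[OF k(2) compact_cball])
  moreover have "interior L \<noteq> {}" using interior_mono[OF sub] k(6) by auto
  ultimately show L: "L \<in> convex_bodies" by (simp add: convex_bodies_def)
  note l = convex_bodiesD[OF L]
  show "hausdorff_dist K L \<le> e"
  proof (rule hausdorff_dist_le)
    show "infdist a L \<le> e" if "a \<in> K" for a
      using that sub e by (simp add: subset_iff)
    show "infdist b K \<le> e" if b: "b \<in> L" for b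
    proof -
      obtain x y where "x \<in> K" "y \<in> cball 0 e" "b = x + y" using b by (auto simp: L_def)
      then show ?thesis using infdist_le2[of x K b e] by (simp add: dist_norm)
    qed
  qed (use k l in auto)
qed

text \<open>A quantitative form of uniqueness of normals that survives a perturbation of the body. If
  \<open>x\<close> lies, up to \<open>e\<close>, in the ball of radius \<open>r\<close> about \<open>c\<close>, and the point of that ball lying
  farthest in the direction \<open>- u\<close> is, up to \<open>e\<close>, still on the inner side of the supporting
  hyperplane at \<open>x\<close>, then \<open>c - x\<close> is within \<open>O (sqrt (r * e))\<close> of \<open>r *\<^sub>R u\<close>. Two normals at \<open>x\<close>
  are both close to \<open>(c - x) / r\<close>, and hence to each other.\<close>

lemma unit_normal_near_ball:
  fixes K :: "'a::euclidean_space set"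
  assumes u: "unit_normal K x u"
    and c: "dist c x \<le> r + e" "0 < e" "e \<le> r"
    and k: "k \<in> K" "dist k (c - r *\<^sub>R u) \<le> e"
  shows "(norm (c - x - r *\<^sub>R u))\<^sup>2 \<le> 5 * r * e"
proof -
  have n: "norm u = 1" "0 \<le> (k - x) \<bullet> u" using u k by (auto simp: unit_normal_def)
  have "(k - (c - r *\<^sub>R u)) \<bullet> u \<le> norm (k - (c - r *\<^sub>R u)) * norm u"
    by (rule norm_cauchy_schwarz)
  also have "\<dots> \<le> e" using k n by (simp add: dist_norm)
  finally have "(c - x) \<bullet> u \<ge> r - e"
    using n by (simp add: inner_diff_left norm_eq_1)
  then have "r * ((c - x) \<bullet> u) \<ge> r * (r - e)" using c by (intro mult_left_mono) auto
  moreover have "(norm (c - x))\<^sup>2 \<le> (r + e)\<^sup>2"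
    using c by (intro power_mono) (auto simp: dist_norm)
  moreover have "(norm (c - x - r *\<^sub>R u))\<^sup>2 = (norm (c - x))\<^sup>2 - 2 * r * ((c - x) \<bullet> u) + r\<^sup>2"
    using n unfolding power2_norm_eq_inner
    by (simp add: inner_diff_left inner_diff_right inner_commute norm_eq_1 algebra_simps power2_eq_square)
  moreover have "e * e \<le> e * r" using c by (intro mult_left_mono) auto
  ultimately show ?thesis by (simp add: algebra_simps power2_eq_square)
qed

text \<open>Each nonempty open set contains an outer parallel body, and all bodies sufficiently close to it
  have only narrow normal cones.\<close>

lemma nowhere_dense_in_wide_normal_cones:
  fixes d :: real
  assumes d: "0 < d"
  shows "nowhere_dense_in convex_body_topology
    {K :: 'a::euclidean_space set \<in> convex_bodies.
       \<exists>x\<in>K. \<exists>u v. unit_normal K x u \<and> unit_normal K x v \<and> d \<le> norm (u - v)}"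
    (is "nowhere_dense_in _ ?N")
proof (rule nowhere_dense_inI)
  fix W :: "'a set set" assume W: "openin convex_body_topology W" "W \<noteq> {}"
  then obtain K where K: "K \<in> W" by blast
  then obtain r where r: "r > 0" "convex_bodies.mball K r \<subseteq> W" and Kb: "K \<in> convex_bodies"
    using W unfolding convex_body_topology_def convex_bodies.openin_mtopology by blast
  define s where "s = r / 2"
  have s: "s > 0" using r by (simp add: s_def)
  define L where "L = {x + y |x y. x \<in> K \<and> y \<in> cball 0 s}"
  note L = outer_parallel_body[OF Kb s, folded L_def]
  have LW: "L \<in> W" using L Kb r by (auto simp: s_def convex_bodies.in_mball)
  \<comment> \<open>Two normals will differ by at most \<open>sqrt (20 * e / s)\<close>, and this has to be below \<open>d\<close>.\<close>
  define e where "e = min s (s * d\<^sup>2 / 21)"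
  have e: "0 < e" "e \<le> s" "21 * e \<le> s * d\<^sup>2" using s d by (auto simp: e_def min_def)
  show "\<exists>V. openin convex_body_topology V \<and> V \<inter> W \<noteq> {} \<and> V \<inter> ?N = {}"
  proof (intro exI conjI)
    show "openin convex_body_topology (convex_bodies.mball L e)"
      by (simp add: convex_body_topology_def)
    show "convex_bodies.mball L e \<inter> W \<noteq> {}" using LW L e convex_bodies.centre_in_mball_iff by blast
    show "convex_bodies.mball L e \<inter> ?N = {}"
    proof (rule ccontr)
      assume "convex_bodies.mball L e \<inter> ?N \<noteq> {}"
      then obtain K' x u v where K': "K' \<in> convex_bodies" "hausdorff_dist L K' < e"
        and x: "x \<in> K'" and u: "unit_normal K' x u" and v: "unit_normal K' x v"
        and uv: "d \<le> norm (u - v)"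
        by (auto simp: convex_bodies.in_mball)
      have "\<exists>x'\<in>L. dist x x' < e"
        using hausdorff_dist_lessD[OF K'(1) L(1)] K'(2) x by (metis hausdorff_dist_commute)
      then obtain x' where x': "x' \<in> L" "dist x x' < e" by blast
      then obtain c y where c: "c \<in> K" "norm y \<le> s" "x' = c + y" by (auto simp: L_def)
      have "dist c x \<le> dist c x' + dist x x'" by (metis dist_triangle dist_commute)
      then have cx: "dist c x \<le> s + e" using c x' by (simp add: dist_norm)
      have near: "(norm (c - x - s *\<^sub>R w))\<^sup>2 \<le> 5 * s * e" if w: "unit_normal K' x w" for w
      proof -
        have "norm w = 1" using w by (simp add: unit_normal_def)
        then have "c - s *\<^sub>R w \<in> L"
          using c s unfolding L_def by (intro CollectI exI[of _ c] exI[of _ "- s *\<^sub>R w"]) auto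
        then obtain k where "k \<in> K'" "dist (c - s *\<^sub>R w) k < e"
          using hausdorff_dist_lessD[OF L(1) K'(1) K'(2)] by blast
        then show ?thesis
          by (intro unit_normal_near_ball[OF w cx e(1,2), of k]) (auto simp: dist_commute)
      qed
      define a b where "a = c - x - s *\<^sub>R u" and "b = c - x - s *\<^sub>R v"
      have "(norm (b - a))\<^sup>2 \<le> 2 * ((norm b)\<^sup>2 + (norm a)\<^sup>2)"
        using inner_ge_zero[of "b + a"] unfolding power2_norm_eq_inner
        by (simp add: inner_add_left inner_add_right inner_diff_left inner_diff_right inner_commute)
      also have "\<dots> \<le> 20 * (s * e)" using near[OF u] near[OF v] by (simp add: a_def b_def)
      finally have "(norm (b - a))\<^sup>2 \<le> 20 * (s * e)" .
      moreover have "b - a = s *\<^sub>R (u - v)" by (simp add: a_def b_def algebra_simps)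
      then have "norm (b - a) = s * norm (u - v)" using s by simp
      ultimately have "s * (s * (norm (u - v))\<^sup>2) \<le> s * (20 * e)"
        using s by (simp add: power_mult_distrib power2_eq_square algebra_simps)
      then have "s * (norm (u - v))\<^sup>2 \<le> 20 * e" using s by simp
      moreover have "s * d\<^sup>2 \<le> s * (norm (u - v))\<^sup>2"
        using s d uv by (intro mult_left_mono power_mono) auto
      ultimately show False using e by linarith
    qed
  qed
qed (auto simp: convex_body_topology_def)

text \<open>The defining function is the gauge of \<open>K\<close> about an interior point \<open>p\<close>, minus 1. The gauge
  is written as the support function of the polar body \<open>P\<close> of \<open>K\<close>, that is \<open>y \<mapsto> max {g \<bullet> (y - p)
  | g \<in> P}\<close>. A maximiser \<open>G y\<close> is, up to a positive factor, an outer normal of \<open>K\<close> at the radial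
  projection of \<open>y\<close>, so that unique normals make it unique. As the set of pairs \<open>(y, g)\<close> with
  \<open>g\<close> a maximiser for \<open>y\<close> is closed and \<open>P\<close> is compact, \<open>G\<close> is continuous. Finally \<open>G\<close> is the
  gradient, because the increment of the gauge from \<open>y\<close> to \<open>z\<close> lies between \<open>G y \<bullet> (z - y)\<close> and
  \<open>G z \<bullet> (z - y)\<close>.\<close>

lemma smooth_boundary_if_unique_normals:
  fixes K :: "'a::euclidean_space set"
  assumes K: "K \<in> convex_bodies" and uniq: "unique_normals K"
  shows "smooth_boundary K"
proof -
  note k = convex_bodiesD[OF K]
  obtain p r where p: "p \<in> interior K" and r: "r > 0" "cball p r \<subseteq> K"
    using k(6) by (metis ex_in_conv mem_interior_cball)
  have pK: "p \<in> K" using p interior_subset by blast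
  obtain B where B: "B > 0" "\<And>y. y \<in> K \<Longrightarrow> norm (y - p) \<le> B"
  proof -
    obtain b where "\<And>y. y \<in> K \<Longrightarrow> dist p y \<le> b"
      using k(4) bounded_any_center[of K p] by blast
    then show ?thesis
      by (intro that[of "max b 1"])
        (auto simp: dist_norm norm_minus_commute max_def le_max_iff_disj intro: order_trans)
  qed
  define P where "P = {g. \<forall>y\<in>K. g \<bullet> (y - p) \<le> 1}"
  have "P = (\<Inter>y\<in>K. {g. g \<bullet> (y - p) \<le> 1})" by (auto simp: P_def)
  moreover have "closed (\<Inter>y\<in>K. {g. g \<bullet> (y - p) \<le> 1})"
    by (intro closed_INT ballI closed_Collect_le continuous_intros)
  ultimately have "closed P" by simp
  moreover have "norm g \<le> 1 / r" if "g \<in> P" for g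
  proof (cases "g = 0")
    case False
    have "p + (r / norm g) *\<^sub>R g \<in> K"
      using r False by (intro subsetD[OF r(2)]) (simp add: dist_norm)
    then have "g \<bullet> (p + (r / norm g) *\<^sub>R g - p) \<le> 1" using that unfolding P_def by blast
    then have "r * norm g \<le> 1" using False by (simp add: power2_norm_eq_inner[symmetric] power2_eq_square)
    then show ?thesis using r by (simp add: field_simps)
  qed (use r in simp)
  ultimately have P: "compact P"
    by (auto simp: compact_eq_bounded_closed bounded_iff)
  have "0 \<in> P" by (simp add: P_def)
  have "\<exists>g\<in>P. \<forall>h\<in>P. h \<bullet> (y - p) \<le> g \<bullet> (y - p)" for y
    using \<open>0 \<in> P\<close> P by (intro continuous_attains_sup continuous_intros) auto
  then obtain G where G: "\<And>y. G y \<in> P" "\<And>y h. h \<in> P \<Longrightarrow> h \<bullet> (y - p) \<le> G y \<bullet> (y - p)"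
    by metis
  \<comment> \<open>The gauge is positive off \<open>p\<close>, since \<open>P\<close> contains a small multiple of \<open>y - p\<close>.\<close>
  have pos: "G y \<bullet> (y - p) > 0" if "y \<noteq> p" for y
  proof -
    define s where "s = (1 / (B * norm (y - p))) *\<^sub>R (y - p)"
    have "s \<bullet> (z - p) \<le> 1" if "z \<in> K" for z
    proof -
      have "s \<bullet> (z - p) \<le> norm s * norm (z - p)" by (rule norm_cauchy_schwarz)
      also have "\<dots> \<le> norm s * B" using B(2)[OF that] by (intro mult_left_mono) auto
      also have "\<dots> = 1" using B(1) \<open>y \<noteq> p\<close> by (simp add: s_def)
      finally show ?thesis .
    qed
    then have "s \<in> P" by (simp add: P_def)
    then have "s \<bullet> (y - p) \<le> G y \<bullet> (y - p)" by (rule G)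
    moreover have "s \<bullet> (y - p) > 0" using B(1) that by (simp add: s_def)
    ultimately show ?thesis by simp
  qed
  \<comment> \<open>The radial projection of \<open>y\<close> lies in \<open>K\<close>: otherwise a separating functional, normalised,
    would be an element of \<open>P\<close> beating \<open>G y\<close>.\<close>
  have bipolar: "p + (1 / (G y \<bullet> (y - p))) *\<^sub>R (y - p) \<in> K" if "y \<noteq> p" for y
  proof (rule ccontr)
    let ?m = "G y \<bullet> (y - p)"
    let ?x = "p + (1 / ?m) *\<^sub>R (y - p)"
    assume "?x \<notin> K"
    then obtain a b where ab: "a \<bullet> ?x < b" "\<And>z. z \<in> K \<Longrightarrow> b < a \<bullet> z"
      using separating_hyperplane_closed_point[of K ?x] k by blast
    define q where "q = a \<bullet> p - b"
    have q: "q > 0" using ab(2)[OF pK] by (simp add: q_def)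
    define h where "h = (- 1 / q) *\<^sub>R a"
    have "h \<in> P"
      using ab(2) q unfolding P_def h_def
      by (auto simp: q_def inner_diff_right divide_simps intro: less_imp_le)
    then have "h \<bullet> (y - p) \<le> ?m" by (rule G)
    then have "h \<bullet> (y - p) / ?m \<le> 1" using pos[OF that] by simp
    moreover have "h \<bullet> (?x - p) = h \<bullet> (y - p) / ?m" by (simp only: add_diff_cancel_left') simp
    ultimately have "h \<bullet> (?x - p) \<le> 1" by simp
    moreover have "h \<bullet> (x - p) = (a \<bullet> p - a \<bullet> x) / q" for x
      using q by (simp add: h_def inner_diff_right field_simps)
    ultimately have "a \<bullet> p - a \<bullet> ?x \<le> q" using q by (simp only: divide_le_eq_1_pos)
    then show False using ab(1) unfolding q_def by linarith
  qed
  \<comment> \<open>Every maximiser yields a unit normal at the radial projection \<open>x\<close>, and the value 1 at \<open>x -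
    p\<close> fixes its length.\<close>
  have maxi: "g = G y" if "y \<noteq> p" "g \<in> P" "G y \<bullet> (y - p) \<le> g \<bullet> (y - p)" for y g
  proof -
    define m where "m = G y \<bullet> (y - p)"
    define x where "x = p + (1 / m) *\<^sub>R (y - p)"
    have m: "m > 0" "x \<in> K" using pos bipolar that by (auto simp: m_def x_def)
    have gm: "g \<bullet> (y - p) = m" using that G(2)[of g y] by (simp add: m_def)
    have one: "g \<bullet> (x - p) = 1" "G y \<bullet> (x - p) = 1"
      using m gm by (simp_all add: x_def) (simp add: m_def)
    have nor: "unit_normal K x (- h /\<^sub>R norm h)" if "h \<in> P" "h \<bullet> (x - p) = 1" for h
    proof -
      have "h \<noteq> 0" using that by auto
      moreover have "0 \<le> (z - x) \<bullet> (- h)" if "z \<in> K" for z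
      proof -
        have "h \<bullet> (z - p) \<le> 1" using that \<open>h \<in> P\<close> by (simp add: P_def)
        then show ?thesis using \<open>h \<bullet> (x - p) = 1\<close>
          by (simp add: inner_diff_right inner_diff_left inner_commute)
      qed
      ultimately show ?thesis by (auto simp: unit_normal_def intro!: mult_nonneg_nonpos)
    qed
    have "- g /\<^sub>R norm g = - G y /\<^sub>R norm (G y)"
      using nor[OF that(2) one(1)] nor[OF G(1) one(2)] m uniq
      unfolding unique_normals_def by blast
    then have eq: "g /\<^sub>R norm g = G y /\<^sub>R norm (G y)" by simp
    then have "(g /\<^sub>R norm g) \<bullet> (x - p) = (G y /\<^sub>R norm (G y)) \<bullet> (x - p)" by simp
    then have "norm g = norm (G y)" using one by simp
    moreover have "g \<noteq> 0" using one by auto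
    ultimately show ?thesis using eq by auto
  qed
  have cont: "continuous_on (- {p}) G"
  proof (subst continuous_closed_graph_eq[OF P])
    show "G \<in> (- {p}) \<rightarrow> P" using G by auto
    have "(\<lambda>x. (x, G x)) ` (- {p}) = ((- {p}) \<times> P) \<inter> (\<Inter>h\<in>P. {z. h \<bullet> (fst z - p) \<le> snd z \<bullet> (fst z - p)})"
      (is "?l = ?r")
    proof
      show "?l \<subseteq> ?r" using G by auto
      show "?r \<subseteq> ?l"
      proof
        fix z assume z: "z \<in> ?r"
        then have "G (fst z) \<bullet> (fst z - p) \<le> snd z \<bullet> (fst z - p)" using G(1) by blast
        then have "snd z = G (fst z)" using z by (intro maxi) auto
        then show "z \<in> ?l" using z by (intro image_eqI[of _ _ "fst z"]) (auto simp: prod_eq_iff)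
      qed
    qed
    moreover have "closed (\<Inter>h\<in>P. {z. h \<bullet> (fst z - p) \<le> snd z \<bullet> (fst z - p)})"
      by (intro closed_INT ballI closed_Collect_le continuous_intros)
    ultimately show "closedin (top_of_set ((- {p}) \<times> P)) ((\<lambda>x. (x, G x)) ` (- {p}))"
      by (simp add: closedin_closed_Int)
  qed
  have der: "GDERIV (\<lambda>y. G y \<bullet> (y - p) - 1) y :> G y" if y: "y \<noteq> p" for y
    unfolding gderiv_def has_derivative_at_alt
  proof (intro conjI allI impI)
    show "bounded_linear (\<lambda>h. h \<bullet> G y)" by (rule bounded_linear_inner_left)
    fix e :: real assume "0 < e"
    have "isCont G y" using cont y by (simp add: continuous_on_eq_continuous_at open_Compl)
    then obtain d where d: "d > 0" "\<And>z. dist z y < d \<Longrightarrow> dist (G z) (G y) < e"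
      using \<open>0 < e\<close> unfolding continuous_at_eps_delta by blast
    show "\<exists>d>0. \<forall>z. norm (z - y) < d \<longrightarrow>
        norm (G z \<bullet> (z - p) - 1 - (G y \<bullet> (y - p) - 1) - (z - y) \<bullet> G y) \<le> e * norm (z - y)"
    proof (intro exI[of _ d] conjI allI impI)
      fix z assume "norm (z - y) < d"
      then have "norm (G z - G y) < e" using d(2)[of z] by (simp add: dist_norm)
      then have "norm (G z - G y) * norm (z - y) \<le> e * norm (z - y)"
        by (intro mult_right_mono) auto
      moreover have "(G z - G y) \<bullet> (z - y) \<le> norm (G z - G y) * norm (z - y)"
        by (rule norm_cauchy_schwarz)
      moreover have "G z \<bullet> (z - p) - G y \<bullet> (y - p) - (z - y) \<bullet> G y \<ge> 0"
        using G(2)[OF G(1)[of y], of z] by (simp add: inner_diff_right inner_diff_left inner_commute)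
      moreover have "G z \<bullet> (z - p) - G y \<bullet> (y - p) - (z - y) \<bullet> G y \<le> (G z - G y) \<bullet> (z - y)"
        using G(2)[OF G(1)[of z], of y] by (simp add: inner_diff_right inner_diff_left inner_commute)
      ultimately show "norm (G z \<bullet> (z - p) - 1 - (G y \<bullet> (y - p) - 1) - (z - y) \<bullet> G y) \<le> e * norm (z - y)"
        by simp
    qed (rule d)
  qed
  have fr: "y \<in> frontier K \<longleftrightarrow> G y \<bullet> (y - p) = 1" if y: "y \<noteq> p" for y
  proof
    assume "y \<in> frontier K"
    then have yK: "y \<in> K" "y \<notin> interior K" using k(3) by (auto simp: frontier_def)
    have ri: "rel_interior K = interior K" using rel_interior_nonempty_interior[OF k(6)] .
    obtain a where a: "\<And>z. z \<in> K \<Longrightarrow> a \<bullet> y \<le> a \<bullet> z" "\<And>z. z \<in> interior K \<Longrightarrow> a \<bullet> y < a \<bullet> z"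
      using supporting_hyperplane_rel_boundary[OF k(1) yK(1)] yK(2) ri by metis
    define q where "q = a \<bullet> p - a \<bullet> y"
    have q: "q > 0" using a(2)[OF p] by (simp add: q_def)
    define h where "h = (- 1 / q) *\<^sub>R a"
    have "h \<in> P"
      using a(1) q unfolding P_def h_def
      by (auto simp: q_def inner_diff_right divide_simps)
    then have "h \<bullet> (y - p) \<le> G y \<bullet> (y - p)" by (rule G)
    moreover have "h \<bullet> (y - p) = q / q"
      using q by (simp add: h_def inner_diff_right field_simps) (simp add: q_def)
    then have "h \<bullet> (y - p) = 1" using q by simp
    moreover have "G y \<bullet> (y - p) \<le> 1" using G(1)[of y] yK by (simp add: P_def)
    ultimately show "G y \<bullet> (y - p) = 1" by simp
  next
    assume one: "G y \<bullet> (y - p) = 1"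
    have yK: "y \<in> K" using bipolar[OF y] one by simp
    have "y \<notin> interior K"
    proof
      assume "y \<in> interior K"
      then obtain s where s: "s > 0" "cball y s \<subseteq> K" using mem_interior_cball by blast
      have nz: "G y \<noteq> 0" using one by auto
      have "y + (s / norm (G y)) *\<^sub>R G y \<in> K"
        using s nz by (intro subsetD[OF s(2)]) (simp add: dist_norm)
      then have "G y \<bullet> (y + (s / norm (G y)) *\<^sub>R G y - p) \<le> 1" using G(1)[of y] by (simp add: P_def)
      then have "s / norm (G y) * (G y \<bullet> G y) \<le> 0"
        using one by (simp add: inner_diff_right inner_add_right)
      moreover have "0 < s / norm (G y) * (G y \<bullet> G y)" using s nz by simp
      ultimately show False by linarith
    qed
    then show "y \<in> frontier K" using yK k(3) by (simp add: frontier_def)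
  qed
  show ?thesis
    unfolding smooth_boundary_def
  proof
    fix x assume "x \<in> frontier K"
    then have "x \<noteq> p" using p by (auto simp: frontier_def)
    have "G y \<noteq> 0" if "y \<noteq> p" for y using pos[OF that] by auto
    then show "\<exists>U g g'. open U \<and> x \<in> U \<and>
        (\<forall>y\<in>U. GDERIV g y :> g' y) \<and> continuous_on U g' \<and> (\<forall>y\<in>U. g' y \<noteq> 0) \<and>
        frontier K \<inter> U = {y \<in> U. g y = 0}"
      using \<open>x \<noteq> p\<close> cont der fr
      by (intro exI[of _ "- {p}"] exI[of _ "\<lambda>y. G y \<bullet> (y - p) - 1"] exI[of _ G]) auto
  qed
qed

section \<open>Touching balls and spikes\<close>

text \<open>For \<open>\<epsilon> > 0\<close>, the inequality says that \<open>z\<close> lies in the closed ball with centre \<open>x + \<epsilon> *\<^sub>R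
  \<nu>\<close> whose boundary passes through \<open>x\<close>. The vector \<open>\<nu>\<close> is deliberately not normalised: the
  construction rescales it, and this way the centre of the ball does not
  change when the touching point is moved towards or away from it. The radius of the ball is \<open>\<epsilon>
  * norm \<nu>\<close>.\<close>

definition in_touching_ball :: "real \<Rightarrow> real \<Rightarrow> 'a::euclidean_space set \<Rightarrow> 'a \<Rightarrow> 'a \<Rightarrow> bool" where
  "in_touching_ball \<epsilon> \<rho> K x \<nu> \<longleftrightarrow>
     x \<in> K \<and> (\<forall>z\<in>K. norm (z - x) \<le> \<rho> \<longrightarrow> (norm (z - x))\<^sup>2 \<le> 2 * \<epsilon> * ((z - x) \<bullet> \<nu>))"

lemma dist_centre_power2:
  fixes x z \<nu> :: "'a::real_inner"
  shows "(dist z (x + \<epsilon> *\<^sub>R \<nu>))\<^sup>2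
    = (dist x (x + \<epsilon> *\<^sub>R \<nu>))\<^sup>2 + ((norm (z - x))\<^sup>2 - 2 * \<epsilon> * ((z - x) \<bullet> \<nu>))"
  unfolding dist_norm power2_norm_eq_inner
  by (simp add: inner_diff_left inner_diff_right inner_add_left inner_add_right inner_commute
      algebra_simps)

lemma dist_centre_le_iff:
  fixes x z \<nu> :: "'a::real_inner"
  shows "dist z (x + \<epsilon> *\<^sub>R \<nu>) \<le> dist x (x + \<epsilon> *\<^sub>R \<nu>)
    \<longleftrightarrow> (norm (z - x))\<^sup>2 \<le> 2 * \<epsilon> * ((z - x) \<bullet> \<nu>)"
proof -
  have "dist z (x + \<epsilon> *\<^sub>R \<nu>) \<le> dist x (x + \<epsilon> *\<^sub>R \<nu>)
    \<longleftrightarrow> (dist z (x + \<epsilon> *\<^sub>R \<nu>))\<^sup>2 \<le> (dist x (x + \<epsilon> *\<^sub>R \<nu>))\<^sup>2"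
    by (rule power_mono_iff[symmetric]) simp_all
  then show ?thesis unfolding dist_centre_power2[of z x] by simp
qed

lemma dist_centre_less_iff:
  fixes x z \<nu> :: "'a::real_inner"
  shows "dist z (x + \<epsilon> *\<^sub>R \<nu>) < dist x (x + \<epsilon> *\<^sub>R \<nu>)
    \<longleftrightarrow> (norm (z - x))\<^sup>2 < 2 * \<epsilon> * ((z - x) \<bullet> \<nu>)"
proof -
  have "dist z (x + \<epsilon> *\<^sub>R \<nu>) < dist x (x + \<epsilon> *\<^sub>R \<nu>)
    \<longleftrightarrow> (dist z (x + \<epsilon> *\<^sub>R \<nu>))\<^sup>2 < (dist x (x + \<epsilon> *\<^sub>R \<nu>))\<^sup>2"
    by (auto intro: power_strict_mono power_less_imp_less_base)
  then show ?thesis unfolding dist_centre_power2[of z x] by simp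
qed

text \<open>The touching ball constrains \<open>K\<close> only close to \<open>x\<close>, but each point of \<open>K\<close> can be moved
  close to \<open>x\<close> along the segment to \<open>x\<close> without leaving \<open>K\<close>.\<close>

lemma in_touching_ball_halfspace:
  fixes K :: "'a::euclidean_space set"
  assumes K: "convex K" and g: "in_touching_ball \<epsilon> \<rho> K x \<nu>" and pos: "0 < \<epsilon>" "0 < \<rho>"
    and y: "y \<in> K" "y \<noteq> x"
  shows "0 < (y - x) \<bullet> \<nu>"
proof -
  have n: "norm (y - x) > 0" using y by simp
  define s where "s = min 1 (\<rho> / norm (y - x))"
  have s: "0 < s" "s \<le> 1" "s * norm (y - x) \<le> \<rho>"
    using pos n by (auto simp: s_def min_def field_simps)
  define z where "z = (1 - s) *\<^sub>R x + s *\<^sub>R y"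
  have "x \<in> K" using g by (simp add: in_touching_ball_def)
  then have zK: "z \<in> K" using K y s unfolding z_def by (intro convexD) auto
  have zx: "z - x = s *\<^sub>R (y - x)" by (simp add: z_def algebra_simps)
  have "norm (z - x) \<le> \<rho>" using s by (simp add: zx)
  then have "(norm (z - x))\<^sup>2 \<le> 2 * \<epsilon> * ((z - x) \<bullet> \<nu>)"
    using g zK unfolding in_touching_ball_def by blast
  moreover have "(norm (z - x))\<^sup>2 > 0" using s y by (simp add: zx)
  ultimately have "0 < 2 * \<epsilon> * ((z - x) \<bullet> \<nu>)" by linarith
  then have "0 < (2 * \<epsilon> * s) * ((y - x) \<bullet> \<nu>)" by (simp add: zx mult.assoc)
  then show ?thesis using pos s by (elim zero_less_mult_pos) simp
qed

lemma convex_body_other_point: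
  fixes K :: "'a::euclidean_space set"
  assumes "K \<in> convex_bodies"
  obtains y where "y \<in> K" "y \<noteq> x"
proof -
  have "interior K \<noteq> {}" using convex_bodiesD[OF assms] by blast
  then have "\<not> K \<subseteq> {x}" using interior_mono[of K "{x}"] by auto
  then show thesis using that by blast
qed

text \<open>Pull the touching point \<open>x\<close> outwards, away from the centre of its touching ball, and take
  the convex hull. The new apex \<open>x'\<close> lies at positive depth behind the supporting hyperplane of
  \<open>K\<close> at \<open>x\<close>, so that the new body lies in a pointed cone there (third claim). The vector \<open>\<nu>'\<close>
  is chosen so that the ball at \<open>x'\<close> has the same centre as the ball at \<open>x\<close> and a larger radius,
  hence still contains the body locally, now touching it only at \<open>x'\<close> (fourth claim).\<close>

lemma spike:
  fixes K :: "'a::euclidean_space set"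
  assumes K: "K \<in> convex_bodies" and g: "in_touching_ball \<epsilon> \<rho> K x \<nu>"
    and pos: "0 < \<epsilon>" "0 < \<rho>" "0 < t"
  defines "x' \<equiv> x - t *\<^sub>R \<nu>" and "\<nu>' \<equiv> (1 + t / \<epsilon>) *\<^sub>R \<nu>"
  defines "L \<equiv> convex hull (insert x' K)"
  shows "L \<in> convex_bodies" "hausdorff_dist K L \<le> t * norm \<nu>"
    "\<exists>c>0. \<forall>z\<in>L. c * norm (z - x') \<le> (z - x') \<bullet> \<nu>'"
    "\<forall>z\<in>L. z \<noteq> x' \<longrightarrow> norm (z - x') \<le> \<rho> - t * norm \<nu> \<longrightarrow>
       (norm (z - x'))\<^sup>2 < 2 * \<epsilon> * ((z - x') \<bullet> \<nu>')"
proof -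
  note k = convex_bodiesD[OF K]
  have xK: "x \<in> K" using g by (simp add: in_touching_ball_def)
  have half: "0 \<le> (y - x) \<bullet> \<nu>" if "y \<in> K" for y
    using in_touching_ball_halfspace[OF k(1) g pos(1,2) that] by (cases "y = x") auto
  have "\<nu> \<noteq> 0"
  proof -
    obtain y where "y \<in> K" "y \<noteq> x" using convex_body_other_point[OF K] .
    then have "0 < (y - x) \<bullet> \<nu>" by (rule in_touching_ball_halfspace[OF k(1) g pos(1,2)])
    then show ?thesis by auto
  qed
  have KL: "K \<subseteq> L" unfolding L_def by (meson hull_subset insert_subset)
  have Lx: "\<exists>u v y. 0 \<le> u \<and> 0 \<le> v \<and> u + v = 1 \<and> y \<in> K \<and> z = u *\<^sub>R x' + v *\<^sub>R y" if "z \<in> L" for z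
    using that unfolding L_def convex_hull_insert[OF k(5)] hull_same[of convex K, OF k(1)] by auto
  have "interior L \<noteq> {}" using interior_mono[OF KL] k(6) by blast
  moreover have "compact L" unfolding L_def using k(2) by (intro compact_convex_hull compact_insert)
  ultimately show L: "L \<in> convex_bodies" by (simp add: convex_bodies_def L_def)
  note l = convex_bodiesD[OF L]
  show "hausdorff_dist K L \<le> t * norm \<nu>"
  proof (rule hausdorff_dist_le)
    show "infdist a L \<le> t * norm \<nu>" if "a \<in> K" for a
      using that KL pos by (simp add: subset_iff)
    show "infdist b K \<le> t * norm \<nu>" if b: "b \<in> L" for b
    proof -
      obtain u v y where *: "0 \<le> u" "0 \<le> v" "u + v = 1" "y \<in> K" "b = u *\<^sub>R x' + v *\<^sub>R y"
        using Lx[OF b] by blast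
      have "u *\<^sub>R x + v *\<^sub>R y \<in> K" using k(1) xK * by (intro convexD)
      moreover have "b - (u *\<^sub>R x + v *\<^sub>R y) = - ((u * t) *\<^sub>R \<nu>)"
        by (simp add: *(5) x'_def algebra_simps)
      then have "dist b (u *\<^sub>R x + v *\<^sub>R y) = u * (t * norm \<nu>)"
        using * pos by (simp add: dist_norm)
      moreover have "u * (t * norm \<nu>) \<le> 1 * (t * norm \<nu>)"
        using * pos by (intro mult_right_mono) auto
      ultimately show ?thesis by (intro infdist_le2[of _ K]) auto
    qed
  qed (use k l in auto)
  show "\<exists>c>0. \<forall>z\<in>L. c * norm (z - x') \<le> (z - x') \<bullet> \<nu>'"
  proof -
    obtain D where D: "\<And>y. y \<in> K \<Longrightarrow> dist x' y \<le> D"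
      using k(4) bounded_any_center[of K x'] by blast
    define h where "h = t * (norm \<nu>)\<^sup>2"
    have h: "h > 0" using pos \<open>\<nu> \<noteq> 0\<close> by (simp add: h_def)
    define D' where "D' = max D 1"
    have D': "D' > 0" "\<And>y. y \<in> K \<Longrightarrow> norm (y - x') \<le> D'"
      using D by (auto simp: D'_def dist_norm norm_minus_commute intro: max.coboundedI1)
    define q where "q = 1 + t / \<epsilon>"
    have q: "q > 0" using pos by (simp add: q_def add_pos_pos)
    show ?thesis
    proof (intro exI[of _ "q * (h / D')"] conjI ballI)
      show "0 < q * (h / D')" using h D' q by simp
      fix z assume "z \<in> L"
      then obtain u v y where *: "0 \<le> u" "0 \<le> v" "u + v = 1" "y \<in> K" "z = u *\<^sub>R x' + v *\<^sub>R y"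
        using Lx by blast
      have zx: "z - x' = v *\<^sub>R (y - x')"
        using *(3) unfolding *(5) by (simp add: algebra_simps flip: scaleR_add_left)
      have "h / D' * norm (y - x') \<le> h / D' * D'"
        using D' h *(4) by (intro mult_left_mono) auto
      also have "\<dots> = h" using D' by simp
      also have "\<dots> \<le> (y - x') \<bullet> \<nu>"
        using half[OF *(4)]
        by (simp add: h_def x'_def inner_diff_left inner_add_left power2_norm_eq_inner)
      finally have "(q * v) * (h / D' * norm (y - x')) \<le> (q * v) * ((y - x') \<bullet> \<nu>)"
        using q * by (intro mult_left_mono) auto
      then show "q * (h / D') * norm (z - x') \<le> (z - x') \<bullet> \<nu>'"
        using *(2) unfolding zx by (simp add: \<nu>'_def q_def[symmetric] mult_ac)
    qed
  qed
  show "\<forall>z\<in>L. z \<noteq> x' \<longrightarrow> norm (z - x') \<le> \<rho> - t * norm \<nu> \<longrightarrow>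
       (norm (z - x'))\<^sup>2 < 2 * \<epsilon> * ((z - x') \<bullet> \<nu>')"
  proof (intro ballI impI)
    fix z assume z: "z \<in> L" "z \<noteq> x'" "norm (z - x') \<le> \<rho> - t * norm \<nu>"
    obtain u v y where *: "0 \<le> u" "0 \<le> v" "u + v = 1" "y \<in> K" "z = u *\<^sub>R x' + v *\<^sub>R y"
      using Lx[OF z(1)] by blast
    have "u \<noteq> 1" using * z(2) by auto
    then have u: "u < 1" using * by simp
    define y' where "y' = u *\<^sub>R x + v *\<^sub>R y"
    have y'K: "y' \<in> K" unfolding y'_def using k(1) xK * by (intro convexD)
    define p where "p = x + \<epsilon> *\<^sub>R \<nu>"
    have p': "p = x' + \<epsilon> *\<^sub>R \<nu>'" using pos by (simp add: p_def x'_def \<nu>'_def algebra_simps)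
    \<comment> \<open>The point \<open>z\<close> of the hull is compared with the point \<open>y'\<close> of \<open>K\<close> obtained by pushing the
      apex back to \<open>x\<close>.\<close>
    have zy: "z = y' - (u * t) *\<^sub>R \<nu>" by (simp add: *(5) y'_def x'_def algebra_simps)
    have "y' - x = (z - x') + ((u - 1) * t) *\<^sub>R \<nu>" by (simp add: zy x'_def algebra_simps)
    then have "norm (y' - x) \<le> norm (z - x') + norm (((u - 1) * t) *\<^sub>R \<nu>)"
      by (metis norm_triangle_ineq)
    also have "norm (((u - 1) * t) *\<^sub>R \<nu>) = (1 - u) * (t * norm \<nu>)" using u pos by (simp add: abs_mult)
    also have "\<dots> \<le> 1 * (t * norm \<nu>)" using * pos by (intro mult_right_mono) auto
    finally have "norm (y' - x) \<le> \<rho>" using z(3) by simp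
    then have "dist y' p \<le> dist x p"
      using g y'K unfolding p_def dist_centre_le_iff in_touching_ball_def by blast
    then have "dist y' p \<le> \<epsilon> * norm \<nu>" using pos by (simp add: p_def dist_norm)
    moreover have "dist z y' = u * (t * norm \<nu>)" using *(1) pos unfolding zy by (simp add: dist_norm)
    moreover have "dist z p \<le> dist z y' + dist y' p" by (rule dist_triangle)
    moreover have "u * (t * norm \<nu>) < 1 * (t * norm \<nu>)"
      using u pos \<open>\<nu> \<noteq> 0\<close> by (intro mult_strict_right_mono) auto
    moreover have "dist x' p = (\<epsilon> + t) * norm \<nu>"
    proof -
      have "x' - p = - ((\<epsilon> + t) *\<^sub>R \<nu>)" by (simp add: x'_def p_def algebra_simps)
      then show ?thesis using pos by (simp add: dist_norm)
    qed
    ultimately have "dist z p < dist x' p" by (simp add: algebra_simps)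
    then show "(norm (z - x'))\<^sup>2 < 2 * \<epsilon> * ((z - x') \<bullet> \<nu>')"
      unfolding p' dist_centre_less_iff .
  qed
qed

text \<open>At a cone, balls of every radius touch, provided one looks at a small enough scale. For
  bodies \<open>K\<close> close to \<open>L\<close> the apex is replaced by the point \<open>y\<close> of \<open>K\<close> farthest from the centre
  \<open>p\<close> of such a ball, among the points of \<open>K\<close> near the apex. By its maximality the ball about
  \<open>p\<close> through \<open>y\<close> contains \<open>K\<close> locally, and \<open>y\<close> is close to the apex, because the points of \<open>L\<close>
  away from the apex are closer to \<open>p\<close> by a definite amount.\<close>

lemma near_spike_touching_ball:
  fixes L :: "'a::euclidean_space set"
  assumes L: "L \<in> convex_bodies" and x: "x \<in> L"
    and cone: "0 < c" "\<And>z. z \<in> L \<Longrightarrow> c * norm (z - x) \<le> (z - x) \<bullet> \<nu>"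
    and pos: "0 < \<epsilon>" "0 < \<rho>" "4 * \<rho> \<le> \<epsilon> * c" "0 < \<eta>"
  shows "\<exists>e>0. \<forall>K\<in>convex_bodies. hausdorff_dist L K < e \<longrightarrow>
    (\<exists>y\<in>ball x \<eta>. \<exists>\<mu>\<in>ball \<nu> \<eta>. in_touching_ball \<epsilon> (2 * \<rho>) K y \<mu>)"
proof -
  define \<kappa> where "\<kappa> = min \<rho> (min \<eta> (\<epsilon> * \<eta>))"
  have \<kappa>: "0 < \<kappa>" "\<kappa> \<le> \<rho>" "\<kappa> \<le> \<eta>" "\<kappa> \<le> \<epsilon> * \<eta>" using pos by (auto simp: \<kappa>_def)
  define p where "p = x + \<epsilon> *\<^sub>R \<nu>"
  define h where "h = \<epsilon> * c * (\<kappa> / 2)"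
  have h: "0 < h" using pos cone \<kappa> by (simp add: h_def)
  define b where "b = dist x p"
  \<comment> \<open>The amount by which the points of \<open>L\<close> at distance at least \<open>\<kappa> / 2\<close> from the apex are closer
    to \<open>p\<close>.\<close>
  define g where "g = b - sqrt (b\<^sup>2 - h)"
  have "sqrt (b\<^sup>2 - h) < sqrt (b\<^sup>2)" using h by (intro real_sqrt_less_mono) simp
  then have g: "0 < g" by (simp add: g_def b_def)
  define e where "e = min (\<kappa> / 2) (g / 2)"
  have e: "0 < e" "e \<le> \<kappa> / 2" "2 * e \<le> g" using g \<kappa> by (auto simp: e_def)
  have far: "dist y p \<le> b - g" if y: "y \<in> L" "\<kappa> / 2 \<le> norm (y - x)" "norm (y - x) \<le> 4 * \<rho>" for y
  proof -
    define n where "n = norm (y - x)"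
    have n: "0 \<le> n" "\<kappa> / 2 \<le> n" "n \<le> \<epsilon> * c" using y pos by (auto simp: n_def)
    have "h \<le> (\<epsilon> * c) * n" unfolding h_def using pos cone n by (intro mult_left_mono) auto
    also have "\<dots> \<le> (2 * \<epsilon> * c - n) * n" using n by (intro mult_right_mono) auto
    also have "\<dots> = 2 * \<epsilon> * (c * n) - n\<^sup>2" by (simp add: algebra_simps power2_eq_square)
    also have "\<dots> \<le> 2 * \<epsilon> * ((y - x) \<bullet> \<nu>) - n\<^sup>2"
      using cone(2)[OF y(1)] pos by (simp add: n_def)
    finally have "(dist y p)\<^sup>2 \<le> b\<^sup>2 - h"
      unfolding b_def p_def by (subst dist_centre_power2) (simp add: n_def)
    then have "dist y p \<le> sqrt (b\<^sup>2 - h)" by (rule real_le_rsqrt)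
    then show ?thesis by (simp add: g_def)
  qed
  show ?thesis
  proof (intro exI[of _ e] conjI ballI impI)
    fix K :: "'a set" assume K: "K \<in> convex_bodies" and d: "hausdorff_dist L K < e"
    obtain q where q: "q \<in> K" "dist x q < e" using hausdorff_dist_lessD[OF L K d x] by blast
    define C where "C = K \<inter> cball x (3 * \<rho>)"
    have "q \<in> C" using q e \<kappa> by (simp add: C_def)
    moreover have "compact C" using convex_bodiesD[OF K] by (auto simp: C_def intro: compact_Int)
    moreover have "continuous_on C (\<lambda>z. dist z p)" by (intro continuous_intros)
    ultimately obtain y where y: "y \<in> C" "\<And>z. z \<in> C \<Longrightarrow> dist z p \<le> dist y p"
      using continuous_attains_sup[of C "\<lambda>z. dist z p"] by blast
    have "dist x p \<le> dist x q + dist q p" by (rule dist_triangle)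
    then have ylow: "b - e < dist y p" using q y(2)[OF \<open>q \<in> C\<close>] by (simp add: b_def)
    have yx: "dist x y < \<kappa>"
    proof (rule ccontr)
      assume "\<not> dist x y < \<kappa>"
      have yK: "y \<in> K" "dist x y \<le> 3 * \<rho>" using y(1) by (auto simp: C_def)
      obtain z where z: "z \<in> L" "dist y z < e"
        using hausdorff_dist_lessD[OF K L, of e y] d yK by (auto simp: hausdorff_dist_commute)
      have "dist x y \<le> dist x z + dist y z" "dist x z \<le> dist x y + dist y z"
        by (metis dist_triangle dist_commute)+
      then have "\<kappa> / 2 \<le> norm (z - x)" "norm (z - x) \<le> 4 * \<rho>"
        using \<open>\<not> dist x y < \<kappa>\<close> yK z(2) e \<kappa> by (auto simp: dist_norm norm_minus_commute)
      then have "dist z p \<le> b - g" using z(1) by (intro far)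
      moreover have "dist y p \<le> dist y z + dist z p" by (rule dist_triangle)
      ultimately show False using ylow z(2) e by linarith
    qed
    define \<mu> where "\<mu> = (1 / \<epsilon>) *\<^sub>R (p - y)"
    have py: "p = y + \<epsilon> *\<^sub>R \<mu>" using pos by (simp add: \<mu>_def)
    have "\<nu> - \<mu> = (1 / \<epsilon>) *\<^sub>R (y - x)" using pos by (simp add: \<mu>_def p_def algebra_simps)
    then have "dist \<nu> \<mu> = dist x y / \<epsilon>" using pos by (simp add: dist_norm norm_minus_commute)
    also have "\<dots> < \<eta>" using yx \<kappa> pos by (simp add: field_simps)
    finally have "\<mu> \<in> ball \<nu> \<eta>" by simp
    moreover have "y \<in> ball x \<eta>" using yx \<kappa> by simp
    moreover have "in_touching_ball \<epsilon> (2 * \<rho>) K y \<mu>"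
      unfolding in_touching_ball_def dist_centre_le_iff[symmetric] py[symmetric]
    proof (intro conjI ballI impI)
      show "y \<in> K" using y by (simp add: C_def)
      fix z assume z: "z \<in> K" "norm (z - y) \<le> 2 * \<rho>"
      have "dist x z \<le> dist x y + dist y z" by (rule dist_triangle)
      then have "z \<in> C" using z yx \<kappa> by (simp add: C_def dist_norm norm_minus_commute)
      then show "dist z p \<le> dist y p" by (rule y)
    qed
    ultimately show "\<exists>y\<in>ball x \<eta>. \<exists>\<mu>\<in>ball \<nu> \<eta>. in_touching_ball \<epsilon> (2 * \<rho>) K y \<mu>" by blast
  qed (rule e)
qed

text \<open>The strict inequality at the apex holds with a uniform margin on a compact annulus about
  the apex, so that it tolerates small changes of the body, of the apex and of the direction.\<close>

lemma near_spike_annulus: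
  fixes L :: "'a::euclidean_space set"
  assumes L: "L \<in> convex_bodies"
    and strict: "\<And>z. \<lbrakk>z \<in> L; z \<noteq> x; norm (z - x) \<le> 3 / 2 * \<rho>\<rbrakk>
      \<Longrightarrow> (norm (z - x))\<^sup>2 < 2 * \<epsilon> * ((z - x) \<bullet> \<nu>)"
    and pos: "0 < \<rho>" "0 < \<rho>'"
  shows "\<exists>e>0. \<forall>K\<in>convex_bodies. hausdorff_dist L K < e \<longrightarrow>
    (\<forall>y\<in>cball x e. \<forall>\<mu>\<in>cball \<nu> e. \<forall>z\<in>K. \<rho>' \<le> norm (z - y) \<longrightarrow> norm (z - y) \<le> \<rho> \<longrightarrow>
       (norm (z - y))\<^sup>2 \<le> 2 * \<epsilon> * ((z - y) \<bullet> \<mu>))"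
proof -
  define f :: "'a \<times> 'a \<Rightarrow> real" where "f = (\<lambda>w. 2 * \<epsilon> * (fst w \<bullet> snd w) - (norm (fst w))\<^sup>2)"
  define A where "A = L \<inter> {z. \<rho>' / 2 \<le> norm (z - x)} \<inter> {z. norm (z - x) \<le> 3 / 2 * \<rho>}"
  have "compact A"
    unfolding A_def using convex_bodiesD(2)[OF L]
    by (intro compact_Int_closed closed_Collect_le continuous_intros)
  have fA: "0 < f (z - x, \<nu>)" if "z \<in> A" for z
  proof -
    have "z \<noteq> x" using that pos by (auto simp: A_def)
    then show ?thesis using strict[of z] that by (auto simp: A_def f_def)
  qed
  have "\<exists>m>0. \<forall>z\<in>A. m \<le> f (z - x, \<nu>)"
  proof (cases "A = {}")
    case False
    have "continuous_on A (\<lambda>z. f (z - x, \<nu>))" unfolding f_def by (intro continuous_intros)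
    then obtain z where "z \<in> A" "\<forall>y\<in>A. f (z - x, \<nu>) \<le> f (y - x, \<nu>)"
      using continuous_attains_inf[OF \<open>compact A\<close> False] by blast
    then show ?thesis using fA by blast
  qed (auto intro: exI[of _ 1])
  then obtain m where m: "0 < m" "\<And>z. z \<in> A \<Longrightarrow> m \<le> f (z - x, \<nu>)" by blast
  have "uniformly_continuous_on (cball 0 (2 * \<rho>) \<times> cball \<nu> 1) f"
    unfolding f_def by (intro compact_uniformly_continuous compact_Times compact_cball continuous_intros)
  then obtain d where d: "0 < d" "\<And>v w. \<lbrakk>v \<in> cball 0 (2 * \<rho>) \<times> cball \<nu> 1;
      w \<in> cball 0 (2 * \<rho>) \<times> cball \<nu> 1; dist w v < d\<rbrakk> \<Longrightarrow> dist (f w) (f v) < m"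
    unfolding uniformly_continuous_on_def using m(1) by metis
  define e where "e = min (min 1 (d / 4)) (min (\<rho>' / 4) (\<rho> / 4))"
  have e: "0 < e" "e \<le> 1" "e \<le> d / 4" "e \<le> \<rho>' / 4" "e \<le> \<rho> / 4" using d pos by (auto simp: e_def)
  show ?thesis
  proof (intro exI[of _ e] conjI ballI impI)
    fix K y \<mu> z
    assume K: "K \<in> convex_bodies" "hausdorff_dist L K < e"
      and y: "y \<in> cball x e" and \<mu>: "\<mu> \<in> cball \<nu> e"
      and z: "z \<in> K" "\<rho>' \<le> norm (z - y)" "norm (z - y) \<le> \<rho>"
    obtain w where w: "w \<in> L" "dist z w < e"
      using hausdorff_dist_lessD[OF K(1) L, of e z] K(2) z(1) by (auto simp: hausdorff_dist_commute)
    have "(w - x) - (z - y) = (y - x) - (z - w)" by simp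
    then have close: "norm ((w - x) - (z - y)) \<le> norm (y - x) + norm (z - w)"
      by (metis norm_triangle_ineq4)
    then have close2: "norm ((w - x) - (z - y)) \<le> 2 * e"
      using y w(2) by (simp add: dist_norm norm_minus_commute)
    have "norm (w - x) \<le> norm (z - y) + norm ((w - x) - (z - y))"
      "norm (z - y) \<le> norm (w - x) + norm ((w - x) - (z - y))"
      by (metis norm_triangle_sub add.commute norm_minus_commute)+
    then have wn: "\<rho>' / 2 \<le> norm (w - x)" "norm (w - x) \<le> 3 / 2 * \<rho>"
      using close2 e z by linarith+
    then have "w \<in> A" using w by (simp add: A_def)
    then have "m \<le> f (w - x, \<nu>)" by (rule m)
    moreover have "dist (f (z - y, \<mu>)) (f (w - x, \<nu>)) < m"
    proof (rule d)
      have "dist (z - y, \<mu>) (w - x, \<nu>) \<le> dist (z - y) (w - x) + dist \<mu> \<nu>"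
        unfolding dist_Pair_Pair by (rule sqrt_sum_squares_le_sum) auto
      also have "\<dots> \<le> 2 * e + e"
        using close2 \<mu> by (intro add_mono) (auto simp: dist_norm norm_minus_commute)
      finally show "dist (z - y, \<mu>) (w - x, \<nu>) < d" using e by linarith
    qed (use wn z pos \<mu> e in auto)
    ultimately have "0 < f (z - y, \<mu>)" by (simp add: dist_real_def)
    then show "(norm (z - y))\<^sup>2 \<le> 2 * \<epsilon> * ((z - y) \<bullet> \<mu>)" by (simp add: f_def)
  qed (rule e)
qed

section \<open>Iterating the construction\<close>

text \<open>One round of the construction. From a body with a touching ball of parameter \<open>\<epsilon>\<close> at scale
  \<open>2 * \<rho>\<close> one passes to the open set \<open>Q\<close> of all bodies near the spiked body. All of these have a
  touching ball of parameter \<open>\<epsilon> / 2\<close> at the smaller scale \<open>2 * \<rho>'\<close>, on which the next round is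
  based. The last claim is what the limit inherits: in the range of scales from \<open>\<rho>'\<close> to \<open>\<rho>\<close> the
  parameter \<open>\<epsilon>\<close> is good for every point \<open>y\<close> and direction \<open>\<mu>\<close> in the boxes, to which all later
  rounds are confined.\<close>

lemma refine_stage:
  fixes K :: "'a::euclidean_space set"
  assumes W: "openin convex_body_topology W" "K \<in> W"
    and g: "in_touching_ball \<epsilon> (2 * \<rho>) K x \<nu>" and pos: "0 < \<epsilon>" "0 < \<rho>" "0 < \<eta>"
  shows "\<exists>Q a w \<eta>' \<rho>'. openin convex_body_topology Q \<and> W \<inter> Q \<noteq> {} \<and>
    0 < \<eta>' \<and> \<eta>' \<le> \<eta> \<and> 0 < \<rho>' \<and> \<rho>' \<le> \<rho> / 2 \<and> cball a \<eta>' \<subseteq> ball x \<eta> \<and> cball w \<eta>' \<subseteq> ball \<nu> \<eta> \<and>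
    (\<forall>K\<in>Q. \<exists>y\<in>ball a \<eta>'. \<exists>\<mu>\<in>ball w \<eta>'. in_touching_ball (\<epsilon> / 2) (2 * \<rho>') K y \<mu>) \<and>
    (\<forall>K\<in>Q. \<forall>y\<in>cball a \<eta>'. \<forall>\<mu>\<in>cball w \<eta>'. \<forall>z\<in>K. \<rho>' \<le> norm (z - y) \<longrightarrow> norm (z - y) \<le> \<rho> \<longrightarrow>
       (norm (z - y))\<^sup>2 \<le> 2 * \<epsilon> * ((z - y) \<bullet> \<mu>))"
proof -
  obtain r where r: "r > 0" "convex_bodies.mball K r \<subseteq> W" and K: "K \<in> convex_bodies"
    using W unfolding convex_body_topology_def convex_bodies.openin_mtopology by blast
  have "\<nu> \<noteq> 0"
  proof -
    obtain y where "y \<in> K" "y \<noteq> x" using convex_body_other_point[OF K] .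
    then have "0 < (y - x) \<bullet> \<nu>"
      using in_touching_ball_halfspace[OF convex_bodiesD(1)[OF K] g] pos by simp
    then show ?thesis by auto
  qed
  \<comment> \<open>The height of the spike: small enough to stay in \<open>W\<close>, in the boxes about \<open>x\<close> and \<open>\<nu>\<close>, and
    to lose at most a quarter of the scale \<open>2 * \<rho>\<close>.\<close>
  define \<tau> where "\<tau> = min (min (\<rho> / 2) (r / 2)) (min (\<eta> / 4) (\<epsilon> * \<eta> / 4))"
  have \<tau>: "0 < \<tau>" "\<tau> \<le> \<rho> / 2" "\<tau> \<le> r / 2" "\<tau> \<le> \<eta> / 4" "\<tau> \<le> \<epsilon> * \<eta> / 4"
    using pos r by (auto simp: \<tau>_def)
  define t where "t = \<tau> / norm \<nu>"
  have t: "0 < t" "t * norm \<nu> = \<tau>" using \<tau> \<open>\<nu> \<noteq> 0\<close> by (auto simp: t_def)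
  define a where "a = x - t *\<^sub>R \<nu>"
  define w where "w = (1 + t / \<epsilon>) *\<^sub>R \<nu>"
  define L where "L = convex hull (insert a K)"
  have "0 < 2 * \<rho>" using pos by simp
  note sp = spike[OF K g pos(1) \<open>0 < 2 * \<rho>\<close> t(1), folded a_def w_def, folded L_def, unfolded t(2)]
  have aL: "a \<in> L" unfolding L_def by (intro hull_inc) simp
  obtain c where c: "0 < c" "\<And>z. z \<in> L \<Longrightarrow> c * norm (z - a) \<le> (z - a) \<bullet> w"
    using sp(3) by blast
  have "dist a x = \<tau>" using t by (simp add: a_def dist_norm)
  then have ax: "cball a (\<eta> / 2) \<subseteq> ball x \<eta>" using \<tau> pos by (simp add: cball_subset_ball_iff)
  have "w - \<nu> = (t / \<epsilon>) *\<^sub>R \<nu>" by (simp add: w_def algebra_simps)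
  then have "dist w \<nu> = \<tau> / \<epsilon>" using t pos by (simp add: dist_norm)
  also have "\<dots> \<le> \<eta> / 4" using \<tau> pos by (simp add: field_simps)
  finally have w\<nu>: "cball w (\<eta> / 2) \<subseteq> ball \<nu> \<eta>" using pos by (simp add: cball_subset_ball_iff)
  \<comment> \<open>At scales below this one the cone of slope \<open>c\<close> fits into a ball of half the parameter.\<close>
  define \<rho>' where "\<rho>' = min (\<rho> / 2) (\<epsilon> / 2 * c / 4)"
  have \<rho>': "0 < \<rho>'" "\<rho>' \<le> \<rho> / 2" "4 * \<rho>' \<le> \<epsilon> / 2 * c" using pos c by (auto simp: \<rho>'_def min_def)
  have "(norm (z - a))\<^sup>2 < 2 * \<epsilon> * ((z - a) \<bullet> w)"
    if "z \<in> L" "z \<noteq> a" "norm (z - a) \<le> 3 / 2 * \<rho>" for z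
    using sp(4) that \<tau>(2) by auto
  then obtain e where e: "0 < e" "\<And>K y \<mu> z. \<lbrakk>K \<in> convex_bodies; hausdorff_dist L K < e;
      y \<in> cball a e; \<mu> \<in> cball w e; z \<in> K; \<rho>' \<le> norm (z - y); norm (z - y) \<le> \<rho>\<rbrakk>
      \<Longrightarrow> (norm (z - y))\<^sup>2 \<le> 2 * \<epsilon> * ((z - y) \<bullet> \<mu>)"
    using near_spike_annulus[OF sp(1), of a \<rho> \<epsilon> w \<rho>'] pos \<rho>'(1) by metis
  define \<eta>' where "\<eta>' = min e (\<eta> / 2)"
  have \<eta>': "0 < \<eta>'" "\<eta>' \<le> e" "\<eta>' \<le> \<eta> / 2" using e pos by (auto simp: \<eta>'_def)
  obtain e' where e': "0 < e'" "\<And>K. \<lbrakk>K \<in> convex_bodies; hausdorff_dist L K < e'\<rbrakk> \<Longrightarrow>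
    \<exists>y\<in>ball a \<eta>'. \<exists>\<mu>\<in>ball w \<eta>'. in_touching_ball (\<epsilon> / 2) (2 * \<rho>') K y \<mu>"
    using near_spike_touching_ball[OF sp(1) aL c, of "\<epsilon> / 2" \<rho>' \<eta>'] pos \<rho>' \<eta>' by auto
  let ?Q = "convex_bodies.mball L (min e e')"
  show ?thesis
  proof (intro exI conjI)
    show "openin convex_body_topology ?Q" by (simp add: convex_body_topology_def)
    have "L \<in> convex_bodies.mball K r" using sp(1,2) K \<tau> by simp
    moreover have "L \<in> ?Q" using sp(1) e(1) e'(1) by simp
    ultimately show "W \<inter> ?Q \<noteq> {}" using r(2) by blast
    show "0 < \<eta>'" "\<eta>' \<le> \<eta>" "0 < \<rho>'" "\<rho>' \<le> \<rho> / 2" using \<eta>' \<rho>' by simp_all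
    show "cball a \<eta>' \<subseteq> ball x \<eta>" "cball w \<eta>' \<subseteq> ball \<nu> \<eta>"
      using ax w\<nu> subset_cball[OF \<eta>'(3)] by blast+
    show "\<forall>K\<in>?Q. \<exists>y\<in>ball a \<eta>'. \<exists>\<mu>\<in>ball w \<eta>'. in_touching_ball (\<epsilon> / 2) (2 * \<rho>') K y \<mu>"
      using e'(2) by simp
    show "\<forall>K\<in>?Q. \<forall>y\<in>cball a \<eta>'. \<forall>\<mu>\<in>cball w \<eta>'. \<forall>z\<in>K. \<rho>' \<le> norm (z - y) \<longrightarrow> norm (z - y) \<le> \<rho> \<longrightarrow>
       (norm (z - y))\<^sup>2 \<le> 2 * \<epsilon> * ((z - y) \<bullet> \<mu>)"
    proof (intro ballI impI)
      fix K y \<mu> z assume *: "K \<in> ?Q" "y \<in> cball a \<eta>'" "\<mu> \<in> cball w \<eta>'" "z \<in> K"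
        "\<rho>' \<le> norm (z - y)" "norm (z - y) \<le> \<rho>"
      show "(norm (z - y))\<^sup>2 \<le> 2 * \<epsilon> * ((z - y) \<bullet> \<mu>)"
        using * \<eta>'(2) by (intro e(2)) auto
    qed
  qed
qed

datatype 'a stage = Stage (bodies: "'a set set") (centre: 'a) (direction: 'a)
  (slack: real) (reach: real) (parameter: real)

text \<open>A stage confines the point to be found to a ball about \<open>centre\<close> and its normal direction
  to a ball about \<open>direction\<close>, both of radius \<open>slack\<close>; every body in \<open>bodies\<close> admits a touching
  ball there, at twice the scale \<open>reach\<close> that the next stage has to control: the excess is used
  up by the spike and by the perturbations.\<close>

definition stages :: "'a::euclidean_space stage set" where
  "stages = {s. openin convex_body_topology (bodies s) \<and> 0 < slack s \<and> 0 < reach s \<and> 0 < parameter s \<and>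
     (\<forall>K\<in>bodies s. \<exists>y\<in>ball (centre s) (slack s). \<exists>\<mu>\<in>ball (direction s) (slack s).
        in_touching_ball (parameter s) (2 * reach s) K y \<mu>)}"

definition next_stage :: "'a::euclidean_space stage \<Rightarrow> 'a stage \<Rightarrow> bool" where
  "next_stage s t \<longleftrightarrow>
     cball (centre t) (slack t) \<subseteq> cball (centre s) (slack s) \<and>
     cball (direction t) (slack t) \<subseteq> cball (direction s) (slack s) \<and>
     slack t \<le> slack s / 2 \<and> reach t \<le> reach s / 2 \<and> parameter t = parameter s / 2 \<and>
     (\<forall>K\<in>bodies t. \<forall>y\<in>cball (centre t) (slack t). \<forall>\<mu>\<in>cball (direction t) (slack t). \<forall>z\<in>K.
        reach t \<le> norm (z - y) \<longrightarrow> norm (z - y) \<le> reach s \<longrightarrow>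
        (norm (z - y))\<^sup>2 \<le> 2 * parameter s * ((z - y) \<bullet> \<mu>))"

text \<open>The point of \<open>K\<close> farthest from the origin has a ball about the origin as touching ball, at
  all scales.\<close>

lemma first_stage_exists:
  fixes W :: "'a::euclidean_space set set"
  assumes W: "openin convex_body_topology W" "W \<noteq> {}"
  shows "\<exists>s\<in>stages. W \<inter> bodies s \<noteq> {}"
proof -
  obtain K where K: "K \<in> W" using W by blast
  then have "K \<in> convex_bodies"
    using openin_subset[OF W(1)] by (auto simp: convex_body_topology_def)
  note k = convex_bodiesD[OF this]
  obtain x where x: "x \<in> K" "\<And>z. z \<in> K \<Longrightarrow> dist z 0 \<le> dist x 0"
    using continuous_attains_sup[OF k(2) k(5), of "\<lambda>z. dist z 0"] by (auto intro: continuous_intros)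
  have "in_touching_ball 1 (2 * 1) K x (- x)"
    using x unfolding in_touching_ball_def dist_centre_le_iff[symmetric] by simp
  then obtain Q a w \<eta> \<rho> where
    "openin convex_body_topology Q" "W \<inter> Q \<noteq> {}" "0 < \<eta>" "0 < \<rho>"
    "\<forall>K\<in>Q. \<exists>y\<in>ball a \<eta>. \<exists>\<mu>\<in>ball w \<eta>. in_touching_ball (1 / 2) (2 * \<rho>) K y \<mu>"
    using refine_stage[OF W(1) K _ zero_less_one zero_less_one zero_less_one] by metis
  then show ?thesis
    by (intro bexI[of _ "Stage Q a w \<eta> \<rho> (1 / 2)"]) (simp_all add: stages_def)
qed

lemma next_stage_exists:
  fixes W :: "'a::euclidean_space set set"
  assumes s: "s \<in> stages" and W: "openin convex_body_topology W" "W \<noteq> {}" "W \<subseteq> bodies s"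
  shows "\<exists>t\<in>stages. next_stage s t \<and> W \<inter> bodies t \<noteq> {}"
proof -
  note s' = s[unfolded stages_def mem_Collect_eq]
  obtain K where K: "K \<in> W" using W by blast
  then obtain x \<nu> where x: "x \<in> ball (centre s) (slack s)" and \<nu>: "\<nu> \<in> ball (direction s) (slack s)"
    and g: "in_touching_ball (parameter s) (2 * reach s) K x \<nu>"
    using W(3) s' by blast
  obtain e1 where e1: "0 < e1" "ball x e1 \<subseteq> ball (centre s) (slack s)"
    using openE[OF open_ball x] .
  obtain e2 where e2: "0 < e2" "ball \<nu> e2 \<subseteq> ball (direction s) (slack s)"
    using openE[OF open_ball \<nu>] .
  note e12 = e1 e2
  define \<eta> where "\<eta> = min (slack s / 2) (min e1 e2)"
  have \<eta>: "0 < \<eta>" "\<eta> \<le> slack s / 2" "\<eta> \<le> e1" "\<eta> \<le> e2" using e12 s' by (auto simp: \<eta>_def)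
  obtain Q a w \<eta>' \<rho>' where *: "openin convex_body_topology Q" "W \<inter> Q \<noteq> {}"
    "0 < \<eta>'" "\<eta>' \<le> \<eta>" "0 < \<rho>'" "\<rho>' \<le> reach s / 2" "cball a \<eta>' \<subseteq> ball x \<eta>" "cball w \<eta>' \<subseteq> ball \<nu> \<eta>"
    "\<forall>K\<in>Q. \<exists>y\<in>ball a \<eta>'. \<exists>\<mu>\<in>ball w \<eta>'. in_touching_ball (parameter s / 2) (2 * \<rho>') K y \<mu>"
    "\<forall>K\<in>Q. \<forall>y\<in>cball a \<eta>'. \<forall>\<mu>\<in>cball w \<eta>'. \<forall>z\<in>K. \<rho>' \<le> norm (z - y) \<longrightarrow> norm (z - y) \<le> reach s \<longrightarrow>
       (norm (z - y))\<^sup>2 \<le> 2 * parameter s * ((z - y) \<bullet> \<mu>)"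
    using refine_stage[OF W(1) K g _ _ \<eta>(1)] s' by metis
  let ?t = "Stage Q a w \<eta>' \<rho>' (parameter s / 2)"
  have "?t \<in> stages" using * s' by (simp add: stages_def)
  moreover have "next_stage s ?t"
  proof -
    have "cball a \<eta>' \<subseteq> cball (centre s) (slack s)" "cball w \<eta>' \<subseteq> cball (direction s) (slack s)"
      using *(7,8) e12(2,4) subset_ball[OF \<eta>(3), of x] subset_ball[OF \<eta>(4), of \<nu>] ball_subset_cball
      by blast+
    then show ?thesis using * \<eta>(2) by (simp add: next_stage_def)
  qed
  ultimately show ?thesis using *(2) by (intro bexI[of _ ?t]) auto
qed

lemma halving_bound:
  fixes f :: "nat \<Rightarrow> real"
  assumes "\<And>n. f (Suc n) \<le> f n / 2" "0 < e"
  shows "\<exists>n. f n < e"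
proof -
  have *: "f n \<le> f 0 * (1 / 2) ^ n" for n
  proof (induction n)
    case (Suc n)
    then show ?case using assms(1)[of n] by simp
  qed simp
  have "(\<lambda>n. f 0 * (1 / 2) ^ n) \<longlonglongrightarrow> f 0 * 0"
    by (intro tendsto_mult tendsto_const LIMSEQ_power_zero) simp
  then have "eventually (\<lambda>n. f 0 * (1 / 2) ^ n < e) sequentially"
    using assms(2) by (intro order_tendstoD(2)) auto
  then show ?thesis using * by (auto simp: eventually_sequentially intro: le_less_trans)
qed

text \<open>The boxes shrink to a point \<open>x\<close> and a direction \<open>\<nu>\<close>. Every small distance from \<open>x\<close> falls
  into the range of scales controlled by some stage, and the parameters of the touching balls
  tend to 0.\<close>

lemma stage_limit:
  fixes K :: "'a::euclidean_space set"
  assumes K: "closed K"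
    and \<sigma>: "\<And>n. \<sigma> n \<in> stages" "\<And>n. next_stage (\<sigma> n) (\<sigma> (Suc n))" "\<And>n. K \<in> bodies (\<sigma> n)"
  shows "\<exists>x\<in>K. \<exists>\<nu>. \<forall>\<epsilon>>0. \<exists>\<rho>>0. in_touching_ball \<epsilon> \<rho> K x \<nu>"
proof -
  define h r where "h = (\<lambda>n. reach (\<sigma> n))" and "r = (\<lambda>n. parameter (\<sigma> n))"
  define C D where "C = (\<lambda>n. cball (centre (\<sigma> n)) (slack (\<sigma> n)))"
    and "D = (\<lambda>n. cball (direction (\<sigma> n)) (slack (\<sigma> n)))"
  have pos: "0 < slack (\<sigma> n)" "0 < h n" "0 < r n" for n
    using \<sigma>(1)[of n] by (auto simp: stages_def h_def r_def)
  have halve: "slack (\<sigma> (Suc n)) \<le> slack (\<sigma> n) / 2" "h (Suc n) \<le> h n / 2" "r (Suc n) \<le> r n / 2" for n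
    using \<sigma>(2)[of n] by (auto simp: next_stage_def h_def r_def)
  have "r (Suc n) \<le> r n" for n using halve(3)[of n] pos(3)[of n] by linarith
  then have "decseq r" by (rule decseq_SucI)
  then have r_dec: "r (n + k) \<le> r n" for n k by (rule decseqD) simp
  have "C (Suc n) \<subseteq> C n" "D (Suc n) \<subseteq> D n" for n
    using \<sigma>(2)[of n] unfolding next_stage_def C_def D_def by blast+
  then have nest: "decseq C" "decseq D" by (simp_all add: decseq_Suc_iff)
  have "\<Inter> (range C) \<noteq> {}" "\<Inter> (range D) \<noteq> {}"
    by (rule compact_nest; use nest pos(1) in \<open>simp add: decseq_def C_def D_def not_less less_imp_le\<close>)+
  then obtain x \<nu> where "x \<in> \<Inter> (range C)" "\<nu> \<in> \<Inter> (range D)" by (metis ex_in_conv)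
  then have x: "x \<in> C n" and \<nu>: "\<nu> \<in> D n" for n by simp_all
  have "x \<in> closure K"
    unfolding closure_approachable
  proof (intro allI impI)
    fix e :: real assume "0 < e"
    then obtain n where n: "slack (\<sigma> n) < e / 2"
      using halving_bound[of "\<lambda>n. slack (\<sigma> n)" "e / 2"] halve(1) by auto
    obtain y where "y \<in> K" "dist (centre (\<sigma> n)) y < slack (\<sigma> n)"
      using \<sigma>(1)[of n] \<sigma>(3)[of n] by (fastforce simp: stages_def in_touching_ball_def)
    moreover have "dist (centre (\<sigma> n)) x \<le> slack (\<sigma> n)" using x[of n] by (simp add: C_def)
    ultimately show "\<exists>y\<in>K. dist y x < e"
      using n by (intro bexI[of _ y]) (smt (verit) dist_triangle dist_commute field_sum_of_halves)
  qed
  then have "x \<in> K" using K by simp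
  have band: "(norm (z - x))\<^sup>2 \<le> 2 * r n * ((z - x) \<bullet> \<nu>)"
    if "z \<in> K" "h (Suc n) \<le> norm (z - x)" "norm (z - x) \<le> h n" for z n
    using \<sigma>(2)[of n] \<sigma>(3)[of "Suc n"] x[of "Suc n"] \<nu>[of "Suc n"] that
    unfolding next_stage_def h_def r_def C_def D_def by blast
  show ?thesis
  proof (intro bexI[OF _ \<open>x \<in> K\<close>] exI[of _ \<nu>] allI impI)
    fix \<epsilon> :: real assume "0 < \<epsilon>"
    then obtain n where n: "r n < \<epsilon>" using halving_bound[of r] halve(3) by auto
    show "\<exists>\<rho>>0. in_touching_ball \<epsilon> \<rho> K x \<nu>"
      unfolding in_touching_ball_def
    proof (intro exI[of _ "h n"] conjI ballI impI)
      fix z assume z: "z \<in> K" "norm (z - x) \<le> h n"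
      show "(norm (z - x))\<^sup>2 \<le> 2 * \<epsilon> * ((z - x) \<bullet> \<nu>)"
      proof (cases "z = x")
        case False
        have "\<exists>k. h (Suc (n + k)) \<le> norm (z - x)"
          using halving_bound[of "\<lambda>k. h (Suc (n + k))" "norm (z - x)"] halve(2) False
          by (auto intro: less_imp_le)
        then obtain k where k: "h (Suc (n + k)) \<le> norm (z - x)"
          "\<And>j. j < k \<Longrightarrow> \<not> h (Suc (n + j)) \<le> norm (z - x)"
          using exists_least_iff[of "\<lambda>k. h (Suc (n + k)) \<le> norm (z - x)"] by blast
        \<comment> \<open>By the minimality of \<open>k\<close>, the distance of \<open>z\<close> from \<open>x\<close> lies between two consecutive
          scales.\<close>
        have "norm (z - x) \<le> h (n + k)"
          using z(2) k(2)[of "k - 1"] by (cases k) auto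
        then have b: "(norm (z - x))\<^sup>2 \<le> 2 * r (n + k) * ((z - x) \<bullet> \<nu>)"
          using z k(1) by (intro band)
        moreover have "0 < (norm (z - x))\<^sup>2" using False by simp
        ultimately have "0 < (2 * r (n + k)) * ((z - x) \<bullet> \<nu>)" by linarith
        then have "0 < (z - x) \<bullet> \<nu>" by (rule zero_less_mult_pos) (simp add: pos)
        then have "2 * r (n + k) * ((z - x) \<bullet> \<nu>) \<le> 2 * \<epsilon> * ((z - x) \<bullet> \<nu>)"
          using n r_dec[of n k] by (intro mult_right_mono) auto
        then show ?thesis using b by linarith
      qed simp
    qed (use pos \<open>x \<in> K\<close> in auto)
  qed
qed

lemma first_category_no_infinitely_curved_point:
  "first_category_in convex_body_topology
     {K :: 'a::euclidean_space set \<in> convex_bodies.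
        \<not> (\<exists>x\<in>K. \<exists>\<nu>. \<forall>\<epsilon>>0. \<exists>\<rho>>0. in_touching_ball \<epsilon> \<rho> K x \<nu>)}"
proof -
  have fc: "first_category_in convex_body_topology {K :: 'a set \<in> topspace convex_body_topology.
      \<not> (\<exists>\<sigma>. \<forall>n. \<sigma> n \<in> stages \<and> next_stage (\<sigma> n) (\<sigma> (Suc n)) \<and> K \<in> bodies (\<sigma> n))}"
    using first_stage_exists next_stage_exists
    by (intro first_category_in_no_branch) (simp_all add: stages_def)
  show ?thesis
  proof (rule first_category_in_subset[OF fc], rule subsetI, rule ccontr)
    fix K :: "'a set"
    assume bad: "K \<in> {K \<in> convex_bodies.
        \<not> (\<exists>x\<in>K. \<exists>\<nu>. \<forall>\<epsilon>>0. \<exists>\<rho>>0. in_touching_ball \<epsilon> \<rho> K x \<nu>)}"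
      and "K \<notin> {K \<in> topspace convex_body_topology.
      \<not> (\<exists>\<sigma>. \<forall>n. \<sigma> n \<in> stages \<and> next_stage (\<sigma> n) (\<sigma> (Suc n)) \<and> K \<in> bodies (\<sigma> n))}"
    then obtain \<sigma> where "\<And>n. \<sigma> n \<in> stages" "\<And>n. next_stage (\<sigma> n) (\<sigma> (Suc n))" "\<And>n. K \<in> bodies (\<sigma> n)"
      by (auto simp: convex_body_topology_def)
    then have "\<exists>x\<in>K. \<exists>\<nu>. \<forall>\<epsilon>>0. \<exists>\<rho>>0. in_touching_ball \<epsilon> \<rho> K x \<nu>"
      using bad convex_bodiesD(3) by (intro stage_limit) auto
    then show False using bad by blast
  qed
qed

section \<open>Curvature at the limit point\<close>

text \<open>The points \<open>x + l *\<^sub>R \<nu>\<close> equidistant from \<open>x\<close> and \<open>z\<close> satisfy an equation that is linear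
  in \<open>l\<close>.\<close>

lemma circle_radius_eq:
  fixes x z \<nu> :: "'a::euclidean_space"
  assumes "norm \<nu> = 1" "0 < (z - x) \<bullet> \<nu>"
  shows "circle_radius x \<nu> z = ennreal ((norm (z - x))\<^sup>2 / (2 * ((z - x) \<bullet> \<nu>)))"
proof -
  let ?r = "(norm (z - x))\<^sup>2 / (2 * ((z - x) \<bullet> \<nu>))"
  have through_x: "dist (x + l *\<^sub>R \<nu>) x = l" if "0 \<le> l" for l
    using that assms by (simp add: dist_norm)
  have on_circle: "dist (x + l *\<^sub>R \<nu>) z = l \<longleftrightarrow> l = ?r" if "0 \<le> l" for l
  proof -
    have "(dist z (x + l *\<^sub>R \<nu>))\<^sup>2 = l\<^sup>2 + ((norm (z - x))\<^sup>2 - 2 * l * ((z - x) \<bullet> \<nu>))"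
      using dist_centre_power2[of z x l \<nu>] through_x[OF that] by (simp add: dist_commute)
    moreover have "dist z (x + l *\<^sub>R \<nu>) = l \<longleftrightarrow> (dist z (x + l *\<^sub>R \<nu>))\<^sup>2 = l\<^sup>2"
      using that by (auto intro: power2_eq_imp_eq)
    ultimately have "dist z (x + l *\<^sub>R \<nu>) = l \<longleftrightarrow> (norm (z - x))\<^sup>2 = 2 * l * ((z - x) \<bullet> \<nu>)" by auto
    then show ?thesis using assms(2) by (auto simp: dist_commute field_simps)
  qed
  have "0 \<le> ?r" using assms by simp
  have "(THE r. \<exists>c \<in> {x + l *\<^sub>R \<nu> | l. 0 \<le> l}. dist c x = r \<and> dist c z = r) = ?r"
  proof (rule the_equality)
    show "\<exists>c \<in> {x + l *\<^sub>R \<nu> | l. 0 \<le> l}. dist c x = ?r \<and> dist c z = ?r"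
      using on_circle[OF \<open>0 \<le> ?r\<close>] through_x[OF \<open>0 \<le> ?r\<close>] \<open>0 \<le> ?r\<close> by blast
    show "r = ?r" if r: "\<exists>c \<in> {x + l *\<^sub>R \<nu> | l. 0 \<le> l}. dist c x = r \<and> dist c z = r" for r
    proof -
      obtain l where l: "0 \<le> l" "dist (x + l *\<^sub>R \<nu>) x = r" "dist (x + l *\<^sub>R \<nu>) z = r"
        using r by blast
      then have "l = r" using through_x by simp
      then show ?thesis using l on_circle by simp
    qed
  qed
  then show ?thesis
    using assms(2) unfolding circle_radius_def orthogonal_def by simp
qed

text \<open>Touching balls of arbitrarily small radius force \<open>circle_radius\<close> to tend to 0 at \<open>x\<close>, in
  all tangent directions at once, whence the lower curvature is infinite. For the upper
  curvature one must also exhibit one direction \<open>\<tau>\<close> in which the boundary section accumulates at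
  \<open>x\<close>, as the lower limit of the radii along a trivial filter would be infinite.\<close>

lemma infinitely_curved_point:
  fixes K :: "'a::euclidean_space set"
  assumes K: "K \<in> convex_bodies" and dim: "DIM('a) > 1" and uniq: "unique_normals K"
    and x: "x \<in> K" and touch: "\<And>\<epsilon>. 0 < \<epsilon> \<Longrightarrow> \<exists>\<rho>>0. in_touching_ball \<epsilon> \<rho> K x \<nu>"
  shows "x \<in> frontier K" "lower_curvature K x = \<infinity>" "upper_curvature K x = \<infinity>"
proof -
  note k = convex_bodiesD[OF K]
  obtain \<rho>1 where "\<rho>1 > 0" "in_touching_ball 1 \<rho>1 K x \<nu>" using touch[of 1] by auto
  then have half: "0 < (y - x) \<bullet> \<nu>" if "y \<in> K" "y \<noteq> x" for y
    using in_touching_ball_halfspace[OF k(1)] that by (metis zero_less_one)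
  have \<nu>: "\<nu> \<noteq> 0"
    using convex_body_other_point[OF K, of x] half by (metis inner_zero_right less_irrefl)
  define n where "n = \<nu> /\<^sub>R norm \<nu>"
  have n: "norm n = 1" "\<nu> = norm \<nu> *\<^sub>R n" using \<nu> by (simp_all add: n_def)
  have halfn: "0 < (y - x) \<bullet> n" if "y \<in> K" "y \<noteq> x" for y
    using half[OF that] \<nu> by (simp add: n_def)
  have "unit_normal K x n"
    using n(1) halfn by (force simp: unit_normal_def)
  then have nor: "inward_normal K x = n"
    using uniq x unfolding inward_normal_def unit_normal_def unique_normals_def
    by (intro the_equality) blast+
  show fr: "x \<in> frontier K"
  proof -
    have "x \<notin> interior K"
    proof
      assume "x \<in> interior K"
      then obtain s where s: "s > 0" "cball x s \<subseteq> K" using mem_interior_cball by blast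
      have "x - s *\<^sub>R n \<in> K" using s n by (intro subsetD[OF s(2)]) (simp add: dist_norm)
      moreover have "x - s *\<^sub>R n \<noteq> x" using s n(1) by auto
      ultimately have "0 < (x - s *\<^sub>R n - x) \<bullet> n" by (rule halfn)
      then show False using s n(1) by (simp add: norm_eq_1)
    qed
    then show ?thesis using x k(3) by (simp add: frontier_def)
  qed
  have up0: "upper_radius_dir K x \<tau> = 0" for \<tau>
  proof -
    let ?F = "at x within boundary_section K x \<tau>"
    have "Limsup ?F (circle_radius x n) \<le> 0 + ennreal e" if "0 < e" for e
    proof -
      have "0 < e / norm \<nu>" using that \<nu> by simp
      then obtain \<rho> where \<rho>: "\<rho> > 0" "in_touching_ball (e / norm \<nu>) \<rho> K x \<nu>" using touch by blast
      have "circle_radius x n z \<le> ennreal e"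
        if z: "z \<in> boundary_section K x \<tau>" "z \<noteq> x" "dist z x < \<rho>" for z
      proof -
        have zK: "z \<in> K" using z(1) k(3) frontier_subset_closed by (auto simp: boundary_section_def)
        then have "(norm (z - x))\<^sup>2 \<le> 2 * (e / norm \<nu>) * ((z - x) \<bullet> \<nu>)"
          using \<rho>(2) z(3) unfolding in_touching_ball_def by (simp add: dist_norm)
        also have "\<dots> = e * (2 * ((z - x) \<bullet> n))"
          using \<nu> by (simp add: n_def field_simps)
        finally have "(norm (z - x))\<^sup>2 / (2 * ((z - x) \<bullet> n)) \<le> e"
          using halfn[OF zK z(2)] by (simp add: divide_le_eq)
        then show ?thesis
          using circle_radius_eq[OF n(1) halfn[OF zK z(2)]] by (simp add: ennreal_leI)
      qed
      then have "eventually (\<lambda>z. circle_radius x n z \<le> ennreal e) ?F"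
        using \<rho>(1) unfolding eventually_at by blast
      then show ?thesis by (simp add: Limsup_bounded)
    qed
    then have "Limsup ?F (circle_radius x n) \<le> 0" by (rule ennreal_le_epsilon)
    then show ?thesis by (simp add: upper_radius_dir_def nor)
  qed
  show "lower_curvature K x = \<infinity>"
    unfolding lower_curvature_def lower_curvature_dir_def up0 by (auto simp: INF_constant)
  have "\<exists>\<tau>\<in>tangent_directions K x. upper_curvature_dir K x \<tau> = \<infinity>"
  proof -
    obtain e where e: "e \<noteq> 0" "n \<bullet> e = 0"
      using orthogonal_to_vector_exists[of n] dim by (auto simp: orthogonal_def)
    obtain y0 r where r: "r > 0" "cball y0 r \<subseteq> K" using k(6) by (metis ex_in_conv mem_interior_cball)
    \<comment> \<open>At most one of \<open>y0\<close> and \<open>y1\<close> can lie on the normal line through \<open>x\<close>; the other has a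
      tangential part.\<close>
    define y1 where "y1 = y0 + (r / norm e) *\<^sub>R e"
    have yK: "y0 \<in> K" "y1 \<in> K"
      using r e(1) by (auto intro!: subsetD[OF r(2)] simp: y1_def dist_norm)
    define tangential where "tangential = (\<lambda>y. (y - x) - ((y - x) \<bullet> n) *\<^sub>R n)"
    have "tangential y1 - tangential y0 = (r / norm e) *\<^sub>R e"
      using e(2) by (simp add: tangential_def y1_def inner_diff_left inner_add_left inner_commute algebra_simps)
    moreover have "\<dots> \<noteq> 0" using r e by simp
    ultimately obtain y where y: "y \<in> K" "tangential y \<noteq> 0" using yK by (metis diff_zero)
    define \<tau> l where "\<tau> = tangential y" and "l = (y - x) \<bullet> n"
    have yx: "y - x = l *\<^sub>R n + \<tau>" by (simp add: \<tau>_def l_def tangential_def)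
    have \<tau>: "\<tau> \<noteq> 0" "\<tau> \<bullet> n = 0"
      using y n(1) by (auto simp: \<tau>_def tangential_def inner_diff_left norm_eq_1)
    have "y \<noteq> x" using \<tau> by (auto simp: \<tau>_def tangential_def)
    then have l: "l > 0" using halfn y by (simp add: l_def)
    have "x islimpt boundary_section K x \<tau>"
      unfolding islimpt_approachable
    proof (intro allI impI)
      fix d :: real assume "0 < d"
      define q where "q = l + norm \<tau>"
      have q: "q > 0" using l by (simp add: q_def add_pos_nonneg)
      define s where "s = min 1 (d / (2 * q))"
      have s: "0 < s" "s \<le> 1" "s * q < d" using q \<open>0 < d\<close> by (auto simp: s_def min_def field_simps)
      have in_K: "x + s *\<^sub>R (y - x) \<in> K"
      proof -
        have "(1 - s) *\<^sub>R x + s *\<^sub>R y \<in> K" using k(1) x y s by (intro convexD) auto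
        then show ?thesis by (simp add: algebra_simps)
      qed
      have out_K: "x + s *\<^sub>R \<tau> \<notin> K"
        using halfn[of "x + s *\<^sub>R \<tau>"] \<tau> s by auto
      \<comment> \<open>In direction of the normal, this segment runs from the tangent plane, which is outside
        \<open>K\<close>, to a point of \<open>K\<close>, and so crosses the boundary in the quarter plane.\<close>
      let ?S = "closed_segment (x + s *\<^sub>R \<tau>) (x + s *\<^sub>R (y - x))"
      have "?S \<inter> K \<noteq> {}" "?S - K \<noteq> {}" using in_K out_K by auto
      then have "?S \<inter> frontier K \<noteq> {}" by (intro connected_Int_frontier) auto
      then obtain z where z: "z \<in> frontier K" and "z \<in> ?S" by blast
      then obtain u where u: "0 \<le> u" "u \<le> 1"
        and zu: "z = (1 - u) *\<^sub>R (x + s *\<^sub>R \<tau>) + u *\<^sub>R (x + s *\<^sub>R (y - x))"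
        unfolding in_segment by blast
      have zx: "z = x + (u * s * l) *\<^sub>R n + s *\<^sub>R \<tau>"
        unfolding zu yx by (simp add: algebra_simps)
      then have "z \<in> quarter_plane x n \<tau>"
        using u s l unfolding quarter_plane_def
        by (intro CollectI exI[of _ "u * s * l"] exI[of _ s]) auto
      then have "z \<in> boundary_section K x \<tau>" using z by (simp add: boundary_section_def nor)
      moreover have "z \<noteq> x"
      proof
        assume "z = x"
        then have "((u * s * l) *\<^sub>R n + s *\<^sub>R \<tau>) \<bullet> \<tau> = 0" using zx by simp
        then have "s * (\<tau> \<bullet> \<tau>) = 0" using \<tau>(2) by (simp add: inner_add_left inner_add_right inner_commute)
        then show False using s \<tau>(1) by simp
      qed
      moreover have "dist z x < d"
      proof -
        have "dist z x = norm ((u * s * l) *\<^sub>R n + s *\<^sub>R \<tau>)" by (simp add: dist_norm zx)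
        also have "\<dots> \<le> u * (s * l) + s * norm \<tau>"
          using u s l n(1) by (intro norm_triangle_le) (simp add: abs_mult)
        also have "\<dots> \<le> 1 * (s * l) + s * norm \<tau>"
          using u s l by (intro add_right_mono mult_right_mono) auto
        also have "\<dots> < d" using s(3) by (simp add: q_def algebra_simps)
        finally show ?thesis .
      qed
      ultimately show "\<exists>z\<in>boundary_section K x \<tau>. z \<noteq> x \<and> dist z x < d" by blast
    qed
    then have "lower_radius_dir K x \<tau> \<le> upper_radius_dir K x \<tau>"
      unfolding lower_radius_dir_def upper_radius_dir_def
      by (intro Liminf_le_Limsup) (simp add: trivial_limit_within)
    then have "upper_curvature_dir K x \<tau> = \<infinity>" by (simp add: up0 upper_curvature_dir_def)
    moreover have "\<tau> \<in> tangent_directions K x"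
      using \<tau> by (simp add: tangent_directions_def nor orthogonal_def)
    ultimately show ?thesis by blast
  qed
  then obtain \<tau> where "\<tau> \<in> tangent_directions K x" "upper_curvature_dir K x \<tau> = \<infinity>" by blast
  then have "\<infinity> \<le> upper_curvature K x" unfolding upper_curvature_def by (metis SUP_upper)
  then show "upper_curvature K x = \<infinity>" by (simp add: top_unique)
qed

theorem theorem0p1:
  assumes "DIM('a::euclidean_space) > 1"
  shows "typical_convex_body (\<lambda>K :: 'a set.
           smooth_boundary K \<and>
           (\<exists>x\<in>frontier K. umbilical K x \<and>
              lower_curvature K x = \<infinity> \<and> upper_curvature K x = \<infinity>))"
  unfolding typical_convex_body_def
proof (rule first_category_in_Un)
  show "first_category_in convex_body_topology {K :: 'a set \<in> convex_bodies. \<not> unique_normals K}"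
  proof (rule first_category_in_UN)
    show "nowhere_dense_in convex_body_topology {K :: 'a set \<in> convex_bodies. \<exists>x\<in>K. \<exists>u v.
        unit_normal K x u \<and> unit_normal K x v \<and> 1 / real (Suc n) \<le> norm (u - v)}" for n
      by (rule nowhere_dense_in_wide_normal_cones) simp
    show "{K :: 'a set \<in> convex_bodies. \<not> unique_normals K} \<subseteq> (\<Union>n. {K \<in> convex_bodies. \<exists>x\<in>K. \<exists>u v.
        unit_normal K x u \<and> unit_normal K x v \<and> 1 / real (Suc n) \<le> norm (u - v)})"
    proof
      fix K :: "'a set" assume K: "K \<in> {K \<in> convex_bodies. \<not> unique_normals K}"
      then obtain x u v where *: "x \<in> K" "unit_normal K x u" "unit_normal K x v" "u \<noteq> v"
        by (auto simp: unique_normals_def)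
      then obtain n where "inverse (real (Suc n)) < norm (u - v)"
        using reals_Archimedean[of "norm (u - v)"] by auto
      then have "1 / real (Suc n) \<le> norm (u - v)" by (simp add: inverse_eq_divide)
      then show "K \<in> (\<Union>n. {K \<in> convex_bodies. \<exists>x\<in>K. \<exists>u v.
        unit_normal K x u \<and> unit_normal K x v \<and> 1 / real (Suc n) \<le> norm (u - v)})"
        using * K by blast
    qed
  qed
  show "first_category_in convex_body_topology {K :: 'a set \<in> convex_bodies.
        \<not> (\<exists>x\<in>K. \<exists>\<nu>. \<forall>\<epsilon>>0. \<exists>\<rho>>0. in_touching_ball \<epsilon> \<rho> K x \<nu>)}"
    by (rule first_category_no_infinitely_curved_point)
  show "{K \<in> convex_bodies. \<not> (smooth_boundary K \<and>
           (\<exists>x\<in>frontier K. umbilical K x \<and>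
              lower_curvature K x = \<infinity> \<and> upper_curvature K x = \<infinity>))}
    \<subseteq> {K :: 'a set \<in> convex_bodies. \<not> unique_normals K} \<union> {K :: 'a set \<in> convex_bodies.
        \<not> (\<exists>x\<in>K. \<exists>\<nu>. \<forall>\<epsilon>>0. \<exists>\<rho>>0. in_touching_ball \<epsilon> \<rho> K x \<nu>)}"
  proof (rule subsetI, rule ccontr)
    fix K :: "'a set"
    assume bad: "K \<in> {K \<in> convex_bodies. \<not> (smooth_boundary K \<and>
           (\<exists>x\<in>frontier K. umbilical K x \<and>
              lower_curvature K x = \<infinity> \<and> upper_curvature K x = \<infinity>))}"
      and "K \<notin> {K \<in> convex_bodies. \<not> unique_normals K} \<union> {K \<in> convex_bodies.
        \<not> (\<exists>x\<in>K. \<exists>\<nu>. \<forall>\<epsilon>>0. \<exists>\<rho>>0. in_touching_ball \<epsilon> \<rho> K x \<nu>)}"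
    then obtain x \<nu> where K: "K \<in> convex_bodies" and uniq: "unique_normals K" and x: "x \<in> K"
      and touch: "\<And>\<epsilon>. 0 < \<epsilon> \<Longrightarrow> \<exists>\<rho>>0. in_touching_ball \<epsilon> \<rho> K x \<nu>" by auto
    note inf = infinitely_curved_point[OF K assms uniq x touch]
    show False
      using bad inf smooth_boundary_if_unique_normals[OF K uniq] by (auto simp: umbilical_def)
  qed
qed

end
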